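(* For all sufficiently large integers $n$, we have $\mathrm{tw}(P_n \,\Box\, P_n \,\Box\, P_n) \ge 0.7172\,n^2$, where $\mathrm{tw}$ denotes treewidth.
   Context: $P_n$ denotes the path with $n$ vertices and $\Box$ denotes the Cartesian product of graphs. Treewidth is the usual graph parameter (the minimum, over all tree decompositions, of the maximum bag size minus one). *)

theory Defs
  imports Complex_Main "Graph_Theory.Graph_Theory"
begin

text \<open>
  Finite simple graphs are those \<^typ>\<open>'a pair_pre_digraph\<close> that satisfy \<^const>\<open>pair_graph\<close>:
  finite, loop-free, and with a symmetric arc relation, so that an undirected edge \<open>uv\<close> is
  represented by the two arcs \<open>(u, v)\<close> and \<open>(v, u)\<close>.
\<close>

definition path_graph :: "nat \<Rightarrow> nat pair_pre_digraph" where
  "path_graph n =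
    \<lparr> pverts = {..<n}, parcs = {(i, j). i < n \<and> j < n \<and> (j = Suc i \<or> i = Suc j)} \<rparr>"

definition box_product ::
    "'a pair_pre_digraph \<Rightarrow> 'b pair_pre_digraph \<Rightarrow> ('a \<times> 'b) pair_pre_digraph"
    (infixl \<open>\<box>\<close> 70) where
  "G \<box> H =
    \<lparr> pverts = pverts G \<times> pverts H,
      parcs = {((u, x), (v, y)).
        u = v \<and> u \<in> pverts G \<and> (x, y) \<in> parcs H \<or>
        (u, v) \<in> parcs G \<and> x = y \<and> x \<in> pverts H} \<rparr>"

text \<open>
  The library predicate \<^const>\<open>tree\<close> does not apply to graphs represented by symmetric arc
  relations, because there the two arcs of a single edge already form a directed cycle of length 2.
  A cycle of the underlying simple graph is a directed cycle of length at least 3.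
  Note that \<^const>\<open>connected\<close> entails that the vertex set is nonempty.
\<close>

definition undirected_tree :: "'a pair_pre_digraph \<Rightarrow> bool" where
  "undirected_tree T \<longleftrightarrow>
    pair_graph T \<and> connected (with_proj T) \<and>
    \<not> (\<exists>p. pre_digraph.cycle (with_proj T) p \<and> length p \<ge> 3)"

text \<open>
  Since trees are finite, it is no restriction to take their nodes from \<^typ>\<open>nat\<close>.
\<close>

definition tree_decomposition ::
    "'a pair_pre_digraph \<Rightarrow> nat pair_pre_digraph \<Rightarrow> (nat \<Rightarrow> 'a set) \<Rightarrow> bool" where
  "tree_decomposition G T B \<longleftrightarrow>
    undirected_tree T \<and>
    (\<Union>t\<in>pverts T. B t) = pverts G \<and>
    (\<forall>(u, v)\<in>parcs G. \<exists>t\<in>pverts T. u \<in> B t \<and> v \<in> B t) \<and>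
    (\<forall>v\<in>pverts G. connected (with_proj T \<restriction> {t \<in> pverts T. v \<in> B t}))"

definition decomposition_width :: "nat pair_pre_digraph \<Rightarrow> (nat \<Rightarrow> 'a set) \<Rightarrow> int" where
  "decomposition_width T B = int (Max ((\<lambda>t. card (B t)) ` pverts T)) - 1"

text \<open>
  The integer-valued width avoids truncated subtraction (the graph without vertices has treewidth
  -1). For finite graphs the infimum is a minimum, see \<open>treewidth_attained\<close> below;
  the definition is not meant to be applied to infinite graphs.
\<close>

definition treewidth :: "'a pair_pre_digraph \<Rightarrow> int" where
  "treewidth G = Inf {decomposition_width T B | T B. tree_decomposition G T B}"


lemma pair_graph_iff:
  "pair_graph G \<longleftrightarrow>
    finite (pverts G) \<and> parcs G \<subseteq> pverts G \<times> pverts G \<and> sym (parcs G) \<and> irrefl (parcs G)"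
    (is "?L \<longleftrightarrow> ?R")
proof
  assume ?L
  then interpret pair_graph G .
  show ?R
    using pair_finite_verts pair_sym_arcs pair_no_loops
    by (fastforce simp: symmetric_def irrefl_def dest: in_arcsD1 in_arcsD2)
next
  assume ?R
  moreover from this have "finite (parcs G)"
    using finite_subset by blast
  ultimately show ?L
    by unfold_locales (auto simp: symmetric_def irrefl_def)
qed

lemma pair_graph_path_graph: "pair_graph (path_graph n)"
  by (auto simp: pair_graph_iff path_graph_def sym_def irrefl_def)

lemma pair_graph_box_product:
  assumes "pair_graph G" "pair_graph H"
  shows "pair_graph (G \<box> H)"
  using assms by (auto simp: pair_graph_iff box_product_def sym_def irrefl_def)

lemma single_bag_tree_decomposition:
  assumes "pair_graph G"
  shows "tree_decomposition G \<lparr> pverts = {0}, parcs = {} \<rparr> (\<lambda>_. pverts G)"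
proof -
  let ?T = "\<lparr> pverts = {0::nat}, parcs = {} \<rparr>"
  have conn: "connected H" if "verts H = {0::nat}" for H :: "(nat, nat \<times> nat) pre_digraph"
    using that
    by (auto simp: connected_def strongly_connected_def mk_symmetric_def reachable_def
        intro: rtrancl_on_refl)
  have "\<not> pre_digraph.cycle (with_proj ?T) p" for p
    by (auto simp: pre_digraph.cycle_def pre_digraph.awalk_def)
  then have "undirected_tree ?T"
    by (auto simp: undirected_tree_def conn pair_graph_iff)
  then show ?thesis
    using assms by (auto simp: tree_decomposition_def conn pair_graph_iff)
qed

lemma decomposition_width_ge: "decomposition_width T B \<ge> - 1"
  by (simp add: decomposition_width_def)

lemma treewidth_attained:
  assumes "pair_graph G"
  shows "\<exists>T B. tree_decomposition G T B \<and> decomposition_width T B = treewidth G"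
    and "tree_decomposition G T B \<Longrightarrow> treewidth G \<le> decomposition_width T B"
proof -
  let ?W = "{decomposition_width T B | T B. tree_decomposition G T B}"
  have ne: "?W \<noteq> {}"
    using single_bag_tree_decomposition[OF assms] by blast
  have bdd: "bdd_below ?W"
    by (rule bdd_belowI[of _ "- 1"]) (auto intro: decomposition_width_ge)
  have "Inf ?W \<in> ?W"
  proof -
    obtain w where w: "w \<in> ?W" "w < Inf ?W + 1"
      using cInf_lessD[OF ne, of "Inf ?W + 1"] by auto
    moreover have "Inf ?W \<le> w"
      using w(1) bdd by (rule cInf_lower)
    ultimately have "Inf ?W = w"
      by linarith
    then show ?thesis
      using w(1) by simp
  qed
  then show "\<exists>T B. tree_decomposition G T B \<and> decomposition_width T B = treewidth G"
    by (force simp: treewidth_def)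
  show "tree_decomposition G T B \<Longrightarrow> treewidth G \<le> decomposition_width T B"
    unfolding treewidth_def using bdd by (auto intro!: cInf_lower)
qed

end

theory Submission
  imports Defs
begin

text \<open>
  Some bag \<open>S\<close> of any tree decomposition leaves only colour classes (unions of components of the grid minus
  \<open>S\<close>) of at most half the volume. Cut the cube into horizontal slices. A slice meeting \<open>S\<close> in
  \<open>r < n\<close> points has a row and a column avoiding \<open>S\<close>, so one colour dominates it: all other
  colours together occupy at most \<open>r (r - 1) / 2\<close> of its points. Let \<open>A\<close> be the dominant colour of
  the slice with the smallest \<open>r\<close>, and let \<open>\<alpha>\<close> be the density of \<open>A\<close> in a slice. Since \<open>A\<close> has
  average density at most 1/2, \<open>\<alpha>\<close> travels from near 1 down to a small value, it changes between
  neighbouring slices by at most the size of \<open>S\<close> in a slice, and each slice with density \<open>\<alpha>\<close>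
  costs at least \<open>sqrt (2 min \<alpha> (1 - \<alpha>))\<close>. Minimising the total cost is a one-dimensional
  problem, solved by a calibration \<open>\<Theta>\<close>. The optimal value of the calibration is 3/4, attained at
  \<open>\<mu> = \<beta> = 1/2\<close>; the slightly weaker bound 73/100 is easier to verify.
\<close>

subsection \<open>Balanced bags\<close>

text \<open>A path from \<open>t'\<close> to \<open>t\<close> that avoids the edge closes up with
  \<open>(t, t')\<close> to a cycle. The path has at least two arcs, since the only one-arc path
  would be the removed \<open>(t', t)\<close>. So in a tree, removing an edge separates its
  ends.\<close>

lemma edge_in_long_cycle:
  assumes T: "pair_graph T" and e: "(t, t') \<in> parcs T"
    and conn: "(t', t) \<in> (parcs T - {(t, t'), (t', t)})\<^sup>*"
  shows "\<exists>p. pre_digraph.cycle (with_proj T) p \<and> length p \<ge> 3"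
proof -
  let ?H = "\<lparr> pverts = pverts T, parcs = parcs T - {(t, t'), (t', t)} \<rparr>"
  interpret T: pair_graph T by fact
  have sub: "parcs T \<subseteq> pverts T \<times> pverts T" and irr: "irrefl (parcs T)"
    using T by (auto simp: pair_graph_iff)
  have neq: "t \<noteq> t'"
    using irr e by (auto simp: irrefl_def)
  interpret H: pair_wf_digraph ?H
    using sub by unfold_locales auto
  have "t' \<rightarrow>\<^sup>*\<^bsub>with_proj ?H\<^esub> w" if "(t', w) \<in> (parcs T - {(t, t'), (t', t)})\<^sup>*" for w
    using that
  proof (induction rule: rtrancl_induct)
    case base
    show ?case using e sub by (intro H.reachable_refl) auto
  next
    case (step y z)
    have "(y, z) \<in> parcs ?H"
      using step.hyps(2) by simp
    with step.IH show ?case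
      by (rule H.reachable_adj_trans)
  qed
  with conn obtain p where p: "pre_digraph.apath (with_proj ?H) t' p t"
    using H.reachable_apath by blast
  then have walk: "pre_digraph.awalk (with_proj ?H) t' p t"
    and dist: "distinct (pre_digraph.awalk_verts (with_proj ?H) t' p)"
    by (auto simp: pre_digraph.apath_def)
  \<comment> \<open>\<open>awalk_verts\<close> and \<open>cas\<close> depend only on tails and
    heads, so the path in \<open>?H\<close> can be read in \<open>T\<close>.\<close>
  have verts_eq: "pre_digraph.awalk_verts (with_proj ?H) u q = T.awalk_verts u q" for u q
    by (induction q arbitrary: u) (auto simp: pre_digraph.awalk_verts.simps)
  have cas_eq: "pre_digraph.cas (with_proj ?H) u q v = T.cas u q v" for u q v
    by (induction q arbitrary: u) (auto simp: pre_digraph.cas.simps)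
  have arcs: "set p \<subseteq> parcs T - {(t, t'), (t', t)}" and cas: "T.cas t' p t"
    using walk by (auto simp: pre_digraph.awalk_def cas_eq)
  have "T.cycle ((t, t') # p)"
    unfolding T.cycle_def T.awalk_def
    using e sub arcs cas dist by (intro exI[of _ t]) (auto simp: verts_eq)
  moreover have "length p \<ge> 2"
  proof (cases p)
    case Nil
    then show ?thesis using cas neq by simp
  next
    case (Cons a q)
    then show ?thesis using cas arcs by (cases q) (cases a; auto)+
  qed
  ultimately show ?thesis
    by (intro exI[of _ "(t, t') # p"]) auto
qed

lemma connected_imp_rtrancl:
  assumes "connected H" "u \<in> verts H" "v \<in> verts H" "sym (arcs_ends H)"
  shows "(u, v) \<in> (arcs_ends H)\<^sup>*"
proof -
  have "parcs (mk_symmetric H) = arcs_ends H"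
    using assms(4) by (auto simp: parcs_mk_symmetric arcs_ends_conv sym_def)
  then have "(u, v) \<in> rtrancl_on (verts H) (arcs_ends H)"
    using assms unfolding connected_def strongly_connected_def reachable_def by simp
  then show ?thesis
    by (rule rtrancl_on_rtranclI)
qed

text \<open>For symmetric \<open>E\<close>, the classes of \<open>(avoiding E t)\<^sup>*\<close>
  other than \<open>{t}\<close> are the components left after deleting \<open>t\<close>.\<close>

definition avoiding :: "('a \<times> 'a) set \<Rightarrow> 'a \<Rightarrow> ('a \<times> 'a) set" where
  "avoiding E t = {(u, v) \<in> E. u \<noteq> t \<and> v \<noteq> t}"

text \<open>Take for \<open>t'\<close> the node entered when the walk leaves \<open>t\<close> for
  the last time.\<close>

lemma rtrancl_first_step:
  assumes "(t, u) \<in> E\<^sup>*" "u \<noteq> t"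
  shows "\<exists>t'. (t, t') \<in> E \<and> (t', u) \<in> (avoiding E t)\<^sup>*"
  using assms
proof (induction rule: rtrancl_induct)
  case base
  then show ?case by simp
next
  case (step y z)
  show ?case
  proof (cases "y = t")
    case True
    then show ?thesis using step.hyps by blast
  next
    case False
    then obtain t' where "(t, t') \<in> E" "(t', y) \<in> (avoiding E t)\<^sup>*"
      using step.IH by blast
    moreover have "(y, z) \<in> avoiding E t"
      using step False by (auto simp: avoiding_def)
    ultimately show ?thesis
      by (meson rtrancl.rtrancl_into_rtrancl)
  qed
qed

lemma sym_avoiding: "sym E \<Longrightarrow> sym (avoiding E t)"
  by (auto simp: avoiding_def sym_def)

lemma avoiding_rtrancl_neq:
  assumes "(u, v) \<in> (avoiding E t)\<^sup>*" "u \<noteq> t"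
  shows "v \<noteq> t"
  using assms by (induction rule: rtrancl_induct) (auto simp: avoiding_def)

text \<open>The nodes of a vertex outside \<open>B t\<close> form a subtree that misses
  \<open>t\<close>, so they lie in one component of \<open>T - t\<close>; this component serves as
  the colour. Adjacent vertices share a node and hence a colour.\<close>

theorem balanced_bag:
  assumes G: "pair_graph G" and TD: "tree_decomposition G T B"
  obtains t and col :: "'a \<Rightarrow> nat set" where "t \<in> pverts T"
    and "\<And>u v. (u, v) \<in> parcs G \<Longrightarrow> u \<notin> B t \<Longrightarrow> v \<notin> B t \<Longrightarrow> col u = col v"
    and "\<And>c. 2 * card {v \<in> pverts G - B t. col v = c} \<le> card (pverts G)"
proof -
  let ?E = "parcs T"
  define nodes where "nodes v = {t \<in> pverts T. v \<in> B t}" for v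
  define comp where "comp t u = (avoiding ?E t)\<^sup>* `` {u}" for t u
  \<comment> \<open>All nodes of a vertex outside \<open>B t\<close> give the same component
    (\<open>nodes_comp\<close>), so the choice made by \<open>SOME\<close> is harmless.\<close>
  define col where "col t v = comp t (SOME u. u \<in> nodes v)" for t v
  have cover: "(\<Union>t\<in>pverts T. B t) = pverts G"
    and edges: "\<forall>(u, v)\<in>parcs G. \<exists>t\<in>pverts T. u \<in> B t \<and> v \<in> B t"
    and nodes_conn: "\<forall>v\<in>pverts G. connected (with_proj T \<restriction> nodes v)"
    using TD unfolding tree_decomposition_def nodes_def by simp_all
  have T: "pair_graph T" and conn: "connected (with_proj T)"
    and acyclic: "\<not> (\<exists>p. pre_digraph.cycle (with_proj T) p \<and> length p \<ge> 3)"
    using TD by (auto simp: tree_decomposition_def undirected_tree_def)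
  have fin_G: "finite (pverts G)" and arcs_G: "parcs G \<subseteq> pverts G \<times> pverts G"
    using G by (auto simp: pair_graph_iff)
  have fin: "finite (pverts T)" and sub: "?E \<subseteq> pverts T \<times> pverts T"
    and sym: "sym ?E" and irr: "irrefl ?E"
    using T by (auto simp: pair_graph_iff)
  have ne: "pverts T \<noteq> {}"
    using conn by (auto simp: connected_def strongly_connected_def)
  have sym_av: "sym ((avoiding ?E t)\<^sup>*)" for t
    using sym_avoiding[OF sym] by (rule sym_rtrancl)
  have comp_eq: "comp t u = comp t w" if "w \<in> comp t u" for t u w
    using that sym_av[of t] unfolding comp_def sym_def
    by (auto intro: rtrancl_trans)
  have comp_refl: "u \<in> comp t u" for t u
    by (simp add: comp_def)
  have nodes_ne: "nodes v \<noteq> {}" if "v \<in> pverts G" for v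
    using cover that unfolding nodes_def by blast
  have arcs_proj: "arcs_ends (with_proj T) = ?E"
    by (auto simp: arcs_ends_conv)
  have nodes_comp: "w \<in> comp t u" if "v \<in> pverts G" "v \<notin> B t" "u \<in> nodes v" "w \<in> nodes v" for t u v w
  proof -
    let ?H = "with_proj T \<restriction> nodes v"
    have ends: "arcs_ends ?H = {(a, b) \<in> ?E. a \<in> nodes v \<and> b \<in> nodes v}"
      by (auto simp: arcs_ends_conv)
    have "connected ?H"
      using nodes_conn that(1) by blast
    moreover have "sym (arcs_ends ?H)"
      using sym unfolding ends by (auto simp: sym_def)
    ultimately have "(u, w) \<in> (arcs_ends ?H)\<^sup>*"
      using that by (intro connected_imp_rtrancl) auto
    moreover have "arcs_ends ?H \<subseteq> avoiding ?E t"
      using that(2) unfolding ends avoiding_def nodes_def by auto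
    ultimately show ?thesis
      unfolding comp_def using rtrancl_mono[of "arcs_ends ?H" "avoiding ?E t"] by auto
  qed
  have col_eq: "col t v = comp t u" if "v \<in> pverts G" "v \<notin> B t" "u \<in> nodes v" for t u v
  proof -
    have "(SOME w. w \<in> nodes v) \<in> nodes v"
      using that(3) by (rule someI)
    then have "(SOME w. w \<in> nodes v) \<in> comp t u"
      using nodes_comp that by blast
    then show ?thesis
      unfolding col_def by (rule comp_eq[symmetric])
  qed
  have col_edge: "col t u = col t v"
    if uv: "(u, v) \<in> parcs G" "u \<notin> B t" "v \<notin> B t" for t u v
  proof -
    obtain s where "s \<in> nodes u" "s \<in> nodes v"
      using bspec[OF edges uv(1)] by (auto simp: nodes_def)
    moreover have "u \<in> pverts G" "v \<in> pverts G"
      using uv(1) arcs_G by auto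
    ultimately show ?thesis
      using uv(2,3) by (simp add: col_eq)
  qed
  define big where "big t t' \<longleftrightarrow> t \<in> pverts T \<and> (t, t') \<in> ?E \<and>
    card (pverts G) < 2 * card {v \<in> pverts G - B t. col t v = comp t t'}" for t t'
  \<comment> \<open>Otherwise every node \<open>t\<close> has a neighbour \<open>t'\<close> whose component of \<open>T - t\<close> carries more than
    half of the vertices; passing from \<open>t\<close> to \<open>t'\<close> strictly shrinks that component.\<close>
  have "\<exists>t\<in>pverts T. \<forall>c. 2 * card {v \<in> pverts G - B t. col t v = c} \<le> card (pverts G)"
  proof (rule ccontr)
    assume contr: "\<not> ?thesis"
    have ex_big: "\<exists>t'. big t t'" if t: "t \<in> pverts T" for t
    proof -
      obtain c where c: "card (pverts G) < 2 * card {v \<in> pverts G - B t. col t v = c}"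
        using contr t by (auto simp: not_le)
      then have "{v \<in> pverts G - B t. col t v = c} \<noteq> {}"
        by (metis card.empty mult_0_right not_less_zero)
      then obtain v where v: "v \<in> pverts G" "v \<notin> B t" "col t v = c"
        by auto
      then obtain u where u: "u \<in> nodes v"
        using nodes_ne by blast
      then have "u \<in> pverts T" "u \<noteq> t"
        using v by (auto simp: nodes_def)
      then have "(t, u) \<in> ?E\<^sup>*"
        using connected_imp_rtrancl[OF conn, of t u] t sym by (simp add: arcs_proj)
      then obtain t' where t': "(t, t') \<in> ?E" "u \<in> comp t t'"
        using rtrancl_first_step[OF _ \<open>u \<noteq> t\<close>] by (auto simp: comp_def)
      have "comp t t' = comp t u"
        using t'(2) by (rule comp_eq)
      also have "\<dots> = c"
        using v(3) col_eq[OF v(1,2) u] by simp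
      finally have "comp t t' = c" .
      then show ?thesis
        using t t' c by (auto simp: big_def)
    qed
    define P where "P = {(t, t'). big t t'}"
    have "P \<noteq> {}"
      using ex_big ne by (auto simp: P_def)
    then obtain t t' where tt': "big t t'"
      and min: "\<And>s s'. big s s' \<Longrightarrow> card (comp t t') \<le> card (comp s s')"
    proof -
      obtain p0 where "p0 \<in> P"
        using \<open>P \<noteq> {}\<close> by blast
      from ex_has_least_nat[of "\<lambda>p. p \<in> P", OF this, of "\<lambda>p. card (comp (fst p) (snd p))"]
      obtain p where "p \<in> P"
        and "\<And>q. q \<in> P \<Longrightarrow> card (comp (fst p) (snd p)) \<le> card (comp (fst q) (snd q))"
        by blast
      then show thesis
        by (intro that[of "fst p" "snd p"]) (force simp: P_def)+
    qed
    have edge: "(t, t') \<in> ?E" "(t', t) \<in> ?E" and "t' \<in> pverts T" "t \<noteq> t'"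
      using tt' sub sym irr by (auto simp: big_def sym_def irrefl_def)
    then obtain s where s: "big t' s"
      using ex_big by blast
    have "s \<noteq> t'"
      using s irr by (auto simp: big_def irrefl_def)
    then have t'_notin: "t' \<notin> comp t' s"
      using avoiding_rtrancl_neq[of s t' ?E t'] by (auto simp: comp_def)
    let ?V1 = "{v \<in> pverts G - B t. col t v = comp t t'}"
    let ?V2 = "{v \<in> pverts G - B t'. col t' v = comp t' s}"
    \<comment> \<open>Two sets that each hold more than half of the vertices must meet.\<close>
    have "?V1 \<inter> ?V2 \<noteq> {}"
    proof
      assume "?V1 \<inter> ?V2 = {}"
      then have "card ?V1 + card ?V2 = card (?V1 \<union> ?V2)"
        using fin_G by (intro card_Un_disjoint[symmetric]) auto
      also have "\<dots> \<le> card (pverts G)"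
        using fin_G by (intro card_mono) auto
      finally show False
        using tt' s unfolding big_def by linarith
    qed
    then obtain v u where v: "v \<in> pverts G" "v \<notin> B t" "v \<notin> B t'" "u \<in> nodes v"
      and "comp t u = comp t t'" "comp t' u = comp t' s"
    proof -
      obtain v where v: "v \<in> ?V1" "v \<in> ?V2"
        using \<open>?V1 \<inter> ?V2 \<noteq> {}\<close> by blast
      moreover obtain u where "u \<in> nodes v"
        using v nodes_ne by blast
      ultimately show thesis
        using col_eq[of v t u] col_eq[of v t' u] by (intro that[of v u]) auto
    qed
    then have u: "u \<in> comp t t'" "u \<in> comp t' s"
      using comp_refl by blast+
    \<comment> \<open>Otherwise \<open>u\<close> reaches \<open>t\<close> without \<open>t'\<close>,
      and \<open>t'\<close> reaches \<open>u\<close> without \<open>t\<close>; together these walks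
      join the ends of the edge without using it, which yields a long cycle.\<close>
    have t_notin: "t \<notin> comp t' s"
    proof
      assume "t \<in> comp t' s"
      then have "t \<in> comp t' u"
        using comp_eq[OF u(2)] by simp
      then have "(u, t) \<in> (avoiding ?E t')\<^sup>*" "(t', u) \<in> (avoiding ?E t)\<^sup>*"
        using u by (auto simp: comp_def)
      moreover have "avoiding ?E t' \<subseteq> ?E - {(t, t'), (t', t)}" "avoiding ?E t \<subseteq> ?E - {(t, t'), (t', t)}"
        by (auto simp: avoiding_def)
      ultimately have "(t', u) \<in> (?E - {(t, t'), (t', t)})\<^sup>*" "(u, t) \<in> (?E - {(t, t'), (t', t)})\<^sup>*"
        using rtrancl_mono[THEN subsetD] by metis+
      then have "(t', t) \<in> (?E - {(t, t'), (t', t)})\<^sup>*"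
        by (rule rtrancl_trans)
      then show False
        using edge_in_long_cycle[OF T edge(1)] acyclic by blast
    qed
    have "comp t' s \<subseteq> comp t t'"
    proof
      fix w assume "w \<in> comp t' s"
      then have "(s, w) \<in> (avoiding ?E t')\<^sup>*"
        by (simp add: comp_def)
      \<comment> \<open>Membership in \<open>comp t' s\<close> is carried through the induction
        because it keeps the walk away from \<open>t\<close>.\<close>
      then have "(s, w) \<in> (avoiding ?E t)\<^sup>* \<and> w \<in> comp t' s"
      proof (induction rule: rtrancl_induct)
        case base
        then show ?case by (simp add: comp_refl)
      next
        case (step y z)
        then have "z \<in> comp t' s"
          by (auto simp: comp_def)
        moreover from this step t_notin have "(y, z) \<in> avoiding ?E t"
          by (auto simp: avoiding_def)
        ultimately show ?case
          using step by auto
      qed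
      moreover have "(t', s) \<in> avoiding ?E t"
        using s edge \<open>t \<noteq> t'\<close> t_notin comp_refl[of s t'] by (auto simp: avoiding_def big_def)
      ultimately show "w \<in> comp t t'"
        by (auto simp: comp_def)
    qed
    then have "comp t' s \<subset> comp t t'"
      using t'_notin comp_refl by blast
    moreover have "finite (comp t t')"
    proof -
      have "comp t t' \<subseteq> pverts T"
      proof
        fix w assume "w \<in> comp t t'"
        then have "(t', w) \<in> (avoiding ?E t)\<^sup>*" by (simp add: comp_def)
        then show "w \<in> pverts T"
          by (induction rule: rtrancl_induct) (use \<open>t' \<in> pverts T\<close> sub in \<open>auto simp: avoiding_def\<close>)
      qed
      then show ?thesis using fin finite_subset by blast
    qed
    ultimately have "card (comp t' s) < card (comp t t')"
      by (rule psubset_card_mono[rotated])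
    then show False
      using min[OF s] by simp
  qed
  then show ?thesis
    using that col_edge by blast
qed

subsection \<open>The one-dimensional problem\<close>

text \<open>Walk from \<open>j\<close> to \<open>i\<close> and charge each rise of \<open>f\<close>
  to the index being left. In either direction every index is charged at most once.\<close>

lemma telescoping_bound:
  fixes f e :: "nat \<Rightarrow> real"
  assumes up: "\<And>z. Suc z < n \<Longrightarrow> f (Suc z) - f z \<le> e z"
    and down: "\<And>z. Suc z < n \<Longrightarrow> f z - f (Suc z) \<le> e (Suc z)"
    and nonneg: "\<And>z. z < n \<Longrightarrow> 0 \<le> e z"
    and i: "i < n" and j: "j < n"
  shows "f i - f j \<le> (\<Sum>z<n. e z)"
proof -
  have down_sum: "f a - f b \<le> (\<Sum>z\<in>{a<..b}. e z)" if "a \<le> b" "b < n" for a b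
    using that
  proof (induction b rule: dec_induct)
    case (step b)
    have "{a<..Suc b} = insert (Suc b) {a<..b}"
      using step.hyps by auto
    then show ?case
      using step down[of b] by simp
  qed simp
  have up_sum: "f b - f a \<le> (\<Sum>z\<in>{a..<b}. e z)" if "a \<le> b" "b < n" for a b
    using that
  proof (induction b rule: dec_induct)
    case (step b)
    then show ?case
      using up[of b] by simp
  qed simp
  show ?thesis
  proof (cases "i \<le> j")
    case True
    have "(\<Sum>z\<in>{i<..j}. e z) \<le> (\<Sum>z<n. e z)"
      using j nonneg by (intro sum_mono2) auto
    then show ?thesis using down_sum[OF True j] by simp
  next
    case False
    have "(\<Sum>z\<in>{j..<i}. e z) \<le> (\<Sum>z<n. e z)"
      using i nonneg by (intro sum_mono2) auto
    then show ?thesis using up_sum[of j i] False i by simp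
  qed
qed

section \<open>Polynomial inequalities behind the constant 73/100\<close>

text \<open>The only negative contribution is \<open>d^2 * (5*x + 4*x^2) / 6\<close>. The middle
  term absorbs it, because \<open>3/4 - x - x^2\<close> has the factor \<open>1/2 - x\<close>, which
  is at least \<open>d\<close>.\<close>

lemma profile_polynomial_pos:
  fixes x d :: real
  assumes "0 \<le> x" "0 \<le> d" "d \<le> 1/2 - x"
  shows "0 \<le> x\<^sup>2 + d * (3/4 - x - x\<^sup>2) * x + d\<^sup>2 * (1/2 - 5*x - 4*x\<^sup>2) / 6"
proof -
  have f: "3/4 - x - x\<^sup>2 = (3/2 + x) * (1/2 - x)"
    by (simp add: power2_eq_square field_simps)
  have "d * (d * ((5 + 4 * x) * x)) \<le> d * ((1/2 - x) * ((5 + 4 * x) * x))"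
    using assms by (intro mult_left_mono mult_right_mono) auto
  also have "\<dots> \<le> d * (6 * ((3/2 + x) * (1/2 - x)) * x)"
  proof -
    have "(1/2 - x) * x * (5 + 4 * x) \<le> (1/2 - x) * x * (6 * (3/2 + x))"
      using assms by (intro mult_left_mono) auto
    then show ?thesis
      using assms by (intro mult_left_mono) (auto simp: field_simps)
  qed
  finally have "d\<^sup>2 * (5*x + 4*x\<^sup>2) \<le> 6 * (d * (3/4 - x - x\<^sup>2) * x)"
    unfolding f by (simp add: power2_eq_square algebra_simps)
  moreover have "0 \<le> x\<^sup>2" "0 \<le> d\<^sup>2" by auto
  moreover have "d\<^sup>2 * (1/2 - 5*x - 4*x\<^sup>2) / 6 = d\<^sup>2 / 12 - d\<^sup>2 * (5*x + 4*x\<^sup>2) / 6"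
    by (simp add: field_simps)
  ultimately show ?thesis by linarith
qed

text \<open>As a quadratic in \<open>d\<close> with leading coefficient \<open>P > 0\<close>, the
  right side is bounded by completing the square. The slack 1/50 is 3/4 - 73/100.\<close>

lemma profile_polynomial_neg:
  fixes y d :: real
  assumes "0 \<le> y" "y \<le> 1/2"
  shows "- (1/50) \<le> y\<^sup>2 - d * (3/4 + y - y\<^sup>2) * y + d\<^sup>2 * (1/2 + 5*y - 4*y\<^sup>2) / 6"
proof -
  define b P where "b = 3/4 + y - y\<^sup>2" and "P = (1/2 + 5*y - 4*y\<^sup>2) / 6"
  have yy: "y\<^sup>2 \<le> y / 2"
    using assms mult_left_mono[of y "1/2" y] by (simp add: power2_eq_square)
  then have P: "1/12 \<le> P"
    using assms by (simp add: P_def)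
  have D: "b\<^sup>2 - 4 * P \<le> 23/100 - 73/100 * y"
  proof -
    have "b\<^sup>2 - 4 * P = 11/48 - 11/6 * y + 13/6 * y\<^sup>2 - y\<^sup>2 * (2 * y - y\<^sup>2)"
      by (simp add: b_def P_def power2_eq_square field_simps)
    moreover have "0 \<le> y\<^sup>2 * (2 * y - y\<^sup>2)"
      using assms yy by (intro mult_nonneg_nonneg) auto
    ultimately show ?thesis
      using yy assms by linarith
  qed
  have "y\<^sup>2 * (b\<^sup>2 - 4 * P) \<le> y\<^sup>2 * (23/100 - 73/100 * y)"
    by (intro mult_left_mono D) simp
  \<comment> \<open>Since \<open>P \<ge> 1/12\<close>, the available slack \<open>4 * P / 50\<close>
    is at least 1/150.\<close>
  also have "\<dots> \<le> 1/150"
  proof (cases "y \<le> 1/6")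
    case True
    then have "y * y \<le> 1/6 * (1/6)"
      using assms by (intro mult_mono) auto
    moreover have "y\<^sup>2 * (23/100 - 73/100 * y) \<le> y\<^sup>2 * (23/100)"
      using assms by (intro mult_left_mono) auto
    ultimately show ?thesis by (simp add: power2_eq_square)
  next
    case False
    show ?thesis
    proof (cases "y \<le> 23/73")
      case True
      have "y * (23/100 - 73/100 * y) \<le> 23\<^sup>2/(4*73*100)"
      proof -
        have "0 \<le> (y - 23/146)\<^sup>2" by simp
        then show ?thesis by (simp add: power2_eq_square algebra_simps)
      qed
      then have "y * (y * (23/100 - 73/100 * y)) \<le> 23/73 * (23\<^sup>2/(4*73*100))"
        using assms True by (intro mult_mono) auto
      then show ?thesis by (simp add: power2_eq_square)
    next
      case False
      then have "y\<^sup>2 * (23/100 - 73/100 * y) \<le> 0"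
        by (intro mult_nonneg_nonpos) auto
      then show ?thesis by simp
    qed
  qed
  finally have "y\<^sup>2 * b\<^sup>2 \<le> 4 * P * (y\<^sup>2 + 1/50)"
    using P by (simp add: algebra_simps)
  moreover have "0 \<le> (2 * P * d - y * b)\<^sup>2" by simp
  ultimately have "0 \<le> 4 * P * (P * d\<^sup>2 - d * b * y + y\<^sup>2 + 1/50)"
    by (simp add: power2_eq_square algebra_simps)
  then have "0 \<le> P * d\<^sup>2 - d * b * y + y\<^sup>2 + 1/50"
    using P by (simp add: zero_le_mult_iff)
  then show ?thesis
    by (simp add: b_def P_def algebra_simps)
qed

text \<open>By \<open>(t + t') / 2 \<le> \<sigma>\<close>, the change of \<open>t^2 / 2\<close> is
  at most \<open>\<sigma>\<close> times the change of \<open>t\<close>. This converts a multiplier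
  term weighted by \<open>t - t'\<close> into one weighted by density.\<close>

lemma increment_core:
  fixes t t' k k' \<sigma> :: real
  assumes "t' \<le> t" "t \<le> \<sigma>" "0 < \<sigma>" "0 \<le> k'" "k' \<le> k"
  shows "(t\<^sup>2 - t'\<^sup>2) / 2 - (t - t') * k \<le> (t\<^sup>2 - t'\<^sup>2) / 2 * (1 - k' / \<sigma>)"
proof -
  have "(t + t') / (2 * \<sigma>) * k' \<le> 1 * k'"
    using assms by (intro mult_right_mono) auto
  then have "(t - t') * ((t + t') / (2 * \<sigma>) * k') \<le> (t - t') * k"
    using assms by (intro mult_left_mono) auto
  moreover have "(t - t') * ((t + t') / (2 * \<sigma>) * k') = (t\<^sup>2 - t'\<^sup>2) / 2 * (k' / \<sigma>)"
    using assms(3) by (simp add: power2_eq_square divide_simps) (simp add: algebra_simps)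
  ultimately show ?thesis by (simp only: right_diff_distrib mult_1_right)
qed

lemma max_sqrt_square:
  fixes m u :: real
  assumes "0 \<le> m" "0 \<le> u"
  shows "(max m (sqrt u))\<^sup>2 = max (m\<^sup>2) u"
proof (cases "m \<le> sqrt u")
  case True
  then have "m\<^sup>2 \<le> u"
    using assms power_mono[of m "sqrt u" 2] by simp
  then show ?thesis using True assms by simp
next
  case False
  then have "u \<le> m\<^sup>2"
    using assms power_mono[of "sqrt u" m 2] by simp
  then show ?thesis using False by (simp add: max_def)
qed

lemma max_sqrt_le:
  fixes m u s :: real
  assumes "m \<le> s" "u \<le> s\<^sup>2" "0 \<le> s"
  shows "max m (sqrt u) \<le> s"
  using assms real_sqrt_le_mono[of u "s\<^sup>2"] by simp

text \<open>
  Here \<open>\<mu>\<close> is the least (normalised) slice cost and \<open>\<beta>\<close> the least cost of a slice dominated by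
  another colour. The affine function \<open>\<kappa>\<close> is a Lagrange multiplier for the volume constraint.
  With \<open>\<phi> \<alpha> = sqrt (2 min \<alpha> (1 - \<alpha>))\<close>, \<open>\<Theta>\<close> is a primitive of \<open>1 - \<kappa> / \<phi>\<close>, cut off where
  \<open>\<phi>\<close> falls below \<open>\<mu>\<close> (for densities near 1) or \<open>\<beta>\<close> (for densities near 0); \<open>upper\<close> and
  \<open>lower\<close> express it in the variable \<open>t = \<phi> \<alpha>\<close>, in which it is polynomial.
\<close>

locale profile =
  fixes \<mu> \<beta> :: real
  assumes \<mu>_nonneg: "0 \<le> \<mu>" and \<mu>_le: "\<mu> \<le> \<beta>" and \<beta>_le: "\<beta> \<le> 1"
begin

definition slope :: real where "slope = \<beta> - \<mu>"

text \<open>Normalised to equal \<open>\<mu>\<close> at density \<open>1 - \<mu>^2 / 2\<close>,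
  where \<open>sqrt (2 * (1 - a))\<close> has fallen to \<open>\<mu>\<close>; the slope keeps it at
  most \<open>\<beta>\<close> on nonnegative densities.\<close>

definition \<kappa> :: "real \<Rightarrow> real" where
  "\<kappa> a = \<mu> + slope * (1 - \<mu>\<^sup>2 / 2 - a)"

text \<open>The integral of \<open>\<tau> - \<kappa> (1 - \<tau>^2 / 2)\<close> over
  \<open>\<tau>\<close> from \<open>t\<close> to 1, obtained from
  \<open>1 - \<kappa> / \<phi>\<close> by substituting the density
  \<open>1 - \<tau>^2 / 2\<close>.\<close>

definition upper :: "real \<Rightarrow> real" where
  "upper t = (1 - t\<^sup>2) / 2 - \<kappa> (1/2) * (1 - t) + slope * ((1 - t) / 2 - (1 - t ^ 3) / 6)"

text \<open>The integral of \<open>\<tau> - \<kappa> (\<tau>^2 / 2)\<close> over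
  \<open>\<tau>\<close> from \<open>t\<close> to 1; here the density is
  \<open>\<tau>^2 / 2\<close>.\<close>

definition lower :: "real \<Rightarrow> real" where
  "lower t = (1 - t\<^sup>2) / 2 - \<kappa> (1/2) * (1 - t) - slope * ((1 - t) / 2 - (1 - t ^ 3) / 6)"

definition \<Theta> :: "real \<Rightarrow> real" where
  "\<Theta> a = (if 1/2 \<le> a then upper (max \<mu> (sqrt (2 * (1 - a)))) else - lower (max \<beta> (sqrt (2 * a))))"

section \<open>Bounds on the multiplier\<close>

lemma slope_bounds: "0 \<le> slope" "slope \<le> 1"
  using \<mu>_nonneg \<mu>_le \<beta>_le by (auto simp: slope_def)

lemma \<kappa>_antimono: "a \<le> b \<Longrightarrow> \<kappa> b \<le> \<kappa> a"
  using slope_bounds by (simp add: \<kappa>_def mult_left_mono)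

lemma \<kappa>_diff: "\<kappa> a - \<kappa> b = slope * (b - a)"
  by (simp add: \<kappa>_def algebra_simps)

lemma \<kappa>_le_\<beta>:
  assumes "0 \<le> a"
  shows "\<kappa> a \<le> \<beta>"
proof -
  have "slope * (1 - \<mu>\<^sup>2 / 2 - a) \<le> slope * 1"
    using slope_bounds assms by (intro mult_left_mono) (auto intro: order_trans[of _ 0])
  then show ?thesis by (simp add: \<kappa>_def slope_def)
qed

lemma \<kappa>_nonneg:
  assumes "a \<le> 1"
  shows "0 \<le> \<kappa> a"
proof -
  have "\<mu>\<^sup>2 \<le> \<mu>"
    using \<mu>_nonneg \<mu>_le \<beta>_le by (simp add: power2_eq_square mult_left_le)
  moreover have "slope * (a - 1 + \<mu>\<^sup>2 / 2) \<le> slope * (\<mu> / 2)"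
    using slope_bounds assms calculation by (intro mult_left_mono) auto
  moreover have "slope * (\<mu> / 2) \<le> 1 * (\<mu> / 2)"
    using slope_bounds \<mu>_nonneg by (intro mult_right_mono) auto
  ultimately show ?thesis
    using \<mu>_nonneg by (simp add: \<kappa>_def algebra_simps)
qed

text \<open>The excess over \<open>\<mu>\<close> is
  \<open>slope * ((t + \<mu>) / 2) * (t - \<mu>)\<close>, whose first two factors are at most 1.
  This keeps the multiplier below the cost of a slice.\<close>

lemma \<kappa>_le_root:
  assumes "\<mu> \<le> t" "t \<le> 1"
  shows "\<kappa> (1 - t\<^sup>2 / 2) \<le> t"
proof -
  have "\<kappa> (1 - t\<^sup>2 / 2) = \<mu> + slope * ((t + \<mu>) / 2) * (t - \<mu>)"
    by (simp add: \<kappa>_def field_simps power2_eq_square)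
  moreover have "slope * ((t + \<mu>) / 2) \<le> 1"
    using slope_bounds assms \<mu>_nonneg by (intro mult_le_one) auto
  then have "slope * ((t + \<mu>) / 2) * (t - \<mu>) \<le> 1 * (t - \<mu>)"
    using assms by (intro mult_right_mono) auto
  ultimately show ?thesis by simp
qed

section \<open>Increments and monotonicity of the calibration\<close>

text \<open>\<open>(t^2 + t * t' + t'^2) / 6\<close> is the mean of \<open>\<tau>^2 / 2\<close>
  between \<open>t'\<close> and \<open>t\<close>; as \<open>\<kappa>\<close> is affine, its mean is
  its value at the mean density.\<close>

lemma upper_diff:
  "upper t' - upper t = (t\<^sup>2 - t'\<^sup>2) / 2 - (t - t') * \<kappa> (1 - (t\<^sup>2 + t * t' + t'\<^sup>2) / 6)"
  by (simp add: upper_def \<kappa>_def field_simps power2_eq_square power3_eq_cube)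

lemma lower_diff:
  "lower t - lower t' = (t'\<^sup>2 - t\<^sup>2) / 2 - (t' - t) * \<kappa> ((t\<^sup>2 + t * t' + t'\<^sup>2) / 6)"
  by (simp add: lower_def \<kappa>_def field_simps power2_eq_square power3_eq_cube)

lemma upper_increment:
  assumes "t' \<le> t" "0 \<le> t'" "t \<le> \<sigma>" "0 < \<sigma>"
  shows "upper t' - upper t \<le> (t\<^sup>2 - t'\<^sup>2) / 2 * (1 - \<kappa> (1 - t'\<^sup>2 / 2) / \<sigma>)"
proof -
  have "t' * t' \<le> t * t'" "t' * t' \<le> t * t"
    using assms by (auto intro: mult_mono)
  then have "\<kappa> (1 - t'\<^sup>2 / 2) \<le> \<kappa> (1 - (t\<^sup>2 + t * t' + t'\<^sup>2) / 6)"
    by (intro \<kappa>_antimono) (simp add: power2_eq_square)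
  then show ?thesis
    unfolding upper_diff using assms
    by (intro increment_core \<kappa>_nonneg) auto
qed

lemma lower_increment:
  assumes "t \<le> t'" "0 \<le> t" "t' \<le> \<sigma>" "0 < \<sigma>" "t' \<le> 1"
  shows "lower t - lower t' \<le> (t'\<^sup>2 - t\<^sup>2) / 2 * (1 - \<kappa> (t'\<^sup>2 / 2) / \<sigma>)"
proof -
  have "t * t \<le> t' * t'" "t * t' \<le> t' * t'"
    using assms by (auto intro: mult_mono)
  then have *: "\<kappa> (t'\<^sup>2 / 2) \<le> \<kappa> ((t\<^sup>2 + t * t' + t'\<^sup>2) / 6)"
    by (intro \<kappa>_antimono) (simp add: power2_eq_square)
  have "t'\<^sup>2 \<le> 1"
    using assms by (simp add: power_le_one)
  then have "0 \<le> \<kappa> (t'\<^sup>2 / 2)"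
    by (intro \<kappa>_nonneg) simp
  then show ?thesis
    unfolding lower_diff using assms *
    by (intro increment_core)  auto
qed

text \<open>An averaged form of \<open>\<kappa>_le_root\<close>: the mean of \<open>\<kappa>\<close>
  between \<open>t'\<close> and \<open>t\<close> is at most the mean \<open>(t + t') / 2\<close> of
  \<open>\<tau>\<close>.\<close>

lemma upper_antimono:
  assumes "\<mu> \<le> t'" "t' \<le> t" "t \<le> 1"
  shows "upper t \<le> upper t'"
proof -
  let ?Q = "t\<^sup>2 + t * t' + t'\<^sup>2"
  have *: "t\<^sup>2 - \<mu>\<^sup>2 \<le> 2 * (t - \<mu>)" "t'\<^sup>2 - \<mu>\<^sup>2 \<le> 2 * (t' - \<mu>)"
  proof -
    have "x\<^sup>2 - \<mu>\<^sup>2 \<le> 2 * (x - \<mu>)" if "\<mu> \<le> x" "x \<le> 1" for x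
    proof -
      have "(x + \<mu>) * (x - \<mu>) \<le> 2 * (x - \<mu>)"
        using that by (intro mult_right_mono) auto
      then show ?thesis by (simp add: power2_eq_square algebra_simps)
    qed
    then show "t\<^sup>2 - \<mu>\<^sup>2 \<le> 2 * (t - \<mu>)" "t'\<^sup>2 - \<mu>\<^sup>2 \<le> 2 * (t' - \<mu>)"
      using assms by auto
  qed
  have "t * (t' - \<mu>) \<le> 1 * (t' - \<mu>)" "\<mu> * (t - \<mu>) \<le> 1 * (t - \<mu>)"
    using assms by (intro mult_right_mono; simp)+
  then have "t * t' - \<mu>\<^sup>2 \<le> (t - \<mu>) + (t' - \<mu>)"
    by (simp add: power2_eq_square algebra_simps)
  with * have Q: "?Q / 6 - \<mu>\<^sup>2 / 2 \<le> (t + t') / 2 - \<mu>"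
    by (simp add: field_simps)
  have "\<mu> * \<mu> \<le> t * t" "\<mu> * \<mu> \<le> t * t'" "\<mu> * \<mu> \<le> t' * t'"
    using assms \<mu>_nonneg by (auto intro!: mult_mono)
  then have "0 \<le> ?Q / 6 - \<mu>\<^sup>2 / 2"
    by (simp add: power2_eq_square)
  then have "slope * (?Q / 6 - \<mu>\<^sup>2 / 2) \<le> (t + t') / 2 - \<mu>"
    using slope_bounds Q by (meson mult_left_le_one_le order_trans)
  from add_left_mono[OF this, of \<mu>] have "\<kappa> (1 - ?Q / 6) \<le> (t + t') / 2"
    unfolding \<kappa>_def by simp
  then have "(t - t') * \<kappa> (1 - ?Q / 6) \<le> (t - t') * ((t + t') / 2)"
    using assms by (intro mult_left_mono) auto
  also have "\<dots> = (t\<^sup>2 - t'\<^sup>2) / 2"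
    by (simp add: power2_eq_square field_simps)
  finally show ?thesis
    using upper_diff[of t' t] by linarith
qed

lemma lower_antimono:
  assumes "\<beta> \<le> t" "t \<le> t'"
  shows "lower t' \<le> lower t"
proof -
  let ?Q = "t\<^sup>2 + t * t' + t'\<^sup>2"
  have "0 \<le> t" "0 \<le> t'"
    using assms \<mu>_nonneg \<mu>_le by auto
  then have "\<kappa> (?Q / 6) \<le> \<beta>"
    by (intro \<kappa>_le_\<beta>) simp
  then have "(t' - t) * \<kappa> (?Q / 6) \<le> (t' - t) * ((t + t') / 2)"
    using assms by (intro mult_left_mono) auto
  also have "\<dots> = (t'\<^sup>2 - t\<^sup>2) / 2"
    by (simp add: power2_eq_square field_simps)
  finally show ?thesis
    using lower_diff[of t t'] by linarith
qed

lemma \<Theta>_upper: "1/2 \<le> a \<Longrightarrow> \<Theta> a = upper (max \<mu> (sqrt (2 * (1 - a))))"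
  by (simp add: \<Theta>_def)

text \<open>At density 1/2 both cutoffs give 1, and \<open>upper 1 = lower 1 = 0\<close>, so the two
  branches agree there.\<close>

lemma \<Theta>_lower:
  assumes "a \<le> 1/2"
  shows "\<Theta> a = - lower (max \<beta> (sqrt (2 * a)))"
proof (cases "a = 1/2")
  case True
  have "max \<mu> 1 = 1" "max \<beta> 1 = 1"
    using \<mu>_le \<beta>_le by auto
  then show ?thesis
    unfolding True \<Theta>_def upper_def lower_def by simp
next
  case False
  then show ?thesis
    using assms by (simp add: \<Theta>_def)
qed

text \<open>\<open>\<sigma>\<close> bounds the cost at the sparser end \<open>a\<close>, hence on
  the whole interval. The cutoff at \<open>\<mu>\<close> only shrinks the change of
  \<open>t^2 / 2\<close> and raises the value of \<open>\<kappa>\<close> that is subtracted.\<close>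

lemma \<Theta>_increment_upper:
  assumes "1/2 \<le> a" "a \<le> a'" "a' \<le> 1"
    and "0 < \<sigma>" "\<mu> \<le> \<sigma>" "2 * (1 - a) \<le> \<sigma>\<^sup>2" "\<kappa> a' \<le> \<sigma>"
  shows "\<Theta> a' - \<Theta> a \<le> (a' - a) * (1 - \<kappa> a' / \<sigma>)"
proof -
  define t t' where "t = max \<mu> (sqrt (2 * (1 - a)))" and "t' = max \<mu> (sqrt (2 * (1 - a')))"
  have sq: "t\<^sup>2 = max (\<mu>\<^sup>2) (2 * (1 - a))" "t'\<^sup>2 = max (\<mu>\<^sup>2) (2 * (1 - a'))"
    unfolding t_def t'_def using assms \<mu>_nonneg by (intro max_sqrt_square; simp)+
  have le: "t' \<le> t" "0 \<le> t'"
    unfolding t_def t'_def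
    by (rule max.mono[OF order_refl real_sqrt_le_mono], use assms in simp)
      (use assms \<mu>_nonneg in \<open>simp add: le_max_iff_disj\<close>)
  have "t \<le> \<sigma>"
    unfolding t_def using assms by (intro max_sqrt_le) auto
  have "2 * (1 - a') \<le> t'\<^sup>2"
    unfolding sq by simp
  then have "\<kappa> a' \<le> \<kappa> (1 - t'\<^sup>2 / 2)"
    by (intro \<kappa>_antimono) simp
  then have "1 - \<kappa> (1 - t'\<^sup>2 / 2) / \<sigma> \<le> 1 - \<kappa> a' / \<sigma>"
    using assms by (simp add: divide_right_mono)
  moreover have "0 \<le> 1 - \<kappa> a' / \<sigma>"
    using assms by simp
  moreover have "0 \<le> (t\<^sup>2 - t'\<^sup>2) / 2" "(t\<^sup>2 - t'\<^sup>2) / 2 \<le> a' - a"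
    unfolding sq using assms by auto
  ultimately have "(t\<^sup>2 - t'\<^sup>2) / 2 * (1 - \<kappa> (1 - t'\<^sup>2 / 2) / \<sigma>) \<le> (a' - a) * (1 - \<kappa> a' / \<sigma>)"
    by (meson mult_left_mono mult_right_mono order_trans)
  moreover have "\<Theta> a' - \<Theta> a = upper t' - upper t"
    using assms by (simp add: \<Theta>_upper t_def t'_def)
  ultimately show ?thesis
    using upper_increment[OF le \<open>t \<le> \<sigma>\<close> \<open>0 < \<sigma>\<close>] by linarith
qed

lemma \<Theta>_increment_lower:
  assumes "0 \<le> a" "a \<le> a'" "a' \<le> 1/2"
    and "0 < \<sigma>" "\<beta> \<le> \<sigma>" "2 * a' \<le> \<sigma>\<^sup>2" "\<kappa> a' \<le> \<sigma>"
  shows "\<Theta> a' - \<Theta> a \<le> (a' - a) * (1 - \<kappa> a' / \<sigma>)"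
proof -
  define t t' where "t = max \<beta> (sqrt (2 * a))" and "t' = max \<beta> (sqrt (2 * a'))"
  have \<beta>: "0 \<le> \<beta>" using \<mu>_nonneg \<mu>_le by simp
  have sq: "t\<^sup>2 = max (\<beta>\<^sup>2) (2 * a)" "t'\<^sup>2 = max (\<beta>\<^sup>2) (2 * a')"
    unfolding t_def t'_def using assms \<beta> by (intro max_sqrt_square; simp)+
  have le: "t \<le> t'" "0 \<le> t"
    unfolding t_def t'_def
    by (rule max.mono[OF order_refl real_sqrt_le_mono], use assms in simp)
      (use assms \<beta> in \<open>simp add: le_max_iff_disj\<close>)
  have "t' \<le> \<sigma>"
    unfolding t'_def using assms by (intro max_sqrt_le) auto
  have "t' \<le> 1"
    unfolding t'_def using assms \<beta>_le by (intro max_sqrt_le) auto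
  have nonneg: "0 \<le> 1 - \<kappa> a' / \<sigma>"
    using assms by simp
  have eq: "\<Theta> a' - \<Theta> a = lower t - lower t'"
    using assms by (simp add: \<Theta>_lower t_def t'_def)
  show ?thesis
  proof (cases "\<beta>\<^sup>2 \<le> 2 * a'")
    case True
    then have "t'\<^sup>2 / 2 = a'" "(t'\<^sup>2 - t\<^sup>2) / 2 \<le> a' - a"
      unfolding sq by auto
    moreover from this(2) have "(t'\<^sup>2 - t\<^sup>2) / 2 * (1 - \<kappa> a' / \<sigma>) \<le> (a' - a) * (1 - \<kappa> a' / \<sigma>)"
      using nonneg by (rule mult_right_mono)
    ultimately show ?thesis
      using lower_increment[OF le \<open>t' \<le> \<sigma>\<close> \<open>0 < \<sigma>\<close> \<open>t' \<le> 1\<close>] eq by (smt (verit))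
  next
    \<comment> \<open>Both densities lie below the cutoff, so \<open>\<Theta>\<close> does not
      change.\<close>
    case False
    then have "t'\<^sup>2 = t\<^sup>2"
      unfolding sq using assms by auto
    then have "t' = t"
      using le by (simp add: power2_eq_iff_nonneg)
    then show ?thesis
      using eq nonneg assms by simp
  qed
qed

lemma \<Theta>_increment:
  assumes "0 \<le> a" "a \<le> a'" "a' \<le> 1" "0 < \<sigma>" "\<mu> \<le> \<sigma>" "\<kappa> a' \<le> \<sigma>"
    and "1/2 \<le> a \<Longrightarrow> 2 * (1 - a) \<le> \<sigma>\<^sup>2"
    and "a < 1/2 \<Longrightarrow> \<beta> \<le> \<sigma> \<and> 2 * min a' (1/2) \<le> \<sigma>\<^sup>2"
  shows "\<Theta> a' - \<Theta> a \<le> (a' - a) * (1 - \<kappa> a' / \<sigma>)"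
proof -
  consider "1/2 \<le> a" | "a' \<le> 1/2" "a < 1/2" | "a < 1/2" "1/2 < a'" by linarith
  then show ?thesis
  proof cases
    case 1
    then show ?thesis using assms by (intro \<Theta>_increment_upper) auto
  next
    case 2
    then show ?thesis using assms by (intro \<Theta>_increment_lower) auto
  next
    \<comment> \<open>The interval crosses 1/2, where the cost is 1. Since
      \<open>\<sigma>^2 \<ge> 1\<close>, each half can be treated separately, with
      \<open>\<kappa>\<close> lowered to \<open>\<kappa> a'\<close> on the left half.\<close>
    case 3
    then have \<sigma>: "\<beta> \<le> \<sigma>" "1 \<le> \<sigma>\<^sup>2"
      using assms by auto
    have "\<kappa> (1/2) \<le> \<sigma>"
      using \<kappa>_le_\<beta>[of "1/2"] \<sigma> by simp
    then have "\<Theta> (1/2) - \<Theta> a \<le> (1/2 - a) * (1 - \<kappa> (1/2) / \<sigma>)"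
      using assms \<sigma> 3 by (intro \<Theta>_increment_lower) auto
    also have "\<dots> \<le> (1/2 - a) * (1 - \<kappa> a' / \<sigma>)"
      using 3 assms \<kappa>_antimono[of "1/2" a'] by (intro mult_left_mono) (auto simp: divide_right_mono)
    finally have "\<Theta> (1/2) - \<Theta> a \<le> (1/2 - a) * (1 - \<kappa> a' / \<sigma>)" .
    moreover have "\<Theta> a' - \<Theta> (1/2) \<le> (a' - 1/2) * (1 - \<kappa> a' / \<sigma>)"
      using assms \<sigma> 3 by (intro \<Theta>_increment_upper) auto
    moreover have "(1/2 - a) * k + (a' - 1/2) * k = (a' - a) * k" for k
      by (simp add: algebra_simps)
    ultimately show ?thesis
      by (smt (verit, best))
  qed
qed

lemma \<Theta>_mono:
  assumes "0 \<le> a" "a \<le> a'" "a' \<le> 1"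
  shows "\<Theta> a \<le> \<Theta> a'"
proof -
  have up: "\<Theta> b \<le> \<Theta> b'" if "1/2 \<le> b" "b \<le> b'" "b' \<le> 1" for b b'
    using that \<mu>_le \<beta>_le unfolding \<Theta>_upper[OF that(1)] \<Theta>_upper[OF order_trans[OF that(1,2)]]
    by (intro upper_antimono max.mono) (auto simp: le_max_iff_disj)
  have low: "\<Theta> b \<le> \<Theta> b'" if "b \<le> b'" "b' \<le> 1/2" for b b'
    unfolding \<Theta>_lower[OF that(2)] \<Theta>_lower[OF order_trans[OF that]]
    using that by (simp, intro lower_antimono max.mono) (auto simp: le_max_iff_disj)
  show ?thesis
    using up[of a a'] up[of "1/2" a'] low[of a a'] low[of a "1/2"] assms by linarith
qed

text \<open>The right side is the Lagrangian bound per slice: \<open>\<kappa> (1/2)\<close> comes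
  from the volume constraint, \<open>upper \<mu> + lower \<beta>\<close> is the total rise of
  \<open>\<Theta>\<close>. Centred at 1/2, it is 3/4 plus a quantity that the polynomial
  inequalities bound below by -1/50.\<close>

lemma total_ge: "73/100 \<le> \<kappa> (1/2) + upper \<mu> + lower \<beta>"
proof -
  define x d where "x = \<mu> - 1/2" and "d = \<beta> - \<mu>"
  have \<mu>: "\<mu> = 1/2 + x" and \<beta>: "\<beta> = 1/2 + x + d"
    by (auto simp: x_def d_def)
  have d: "0 \<le> d" "d \<le> 1/2 - x" and x: "- (1/2) \<le> x" "x \<le> 1/2"
    using \<mu>_nonneg \<mu>_le \<beta>_le by (auto simp: x_def d_def)
  have "\<kappa> (1/2) + upper \<mu> + lower \<beta> = 3/4 + x\<^sup>2 + d * (3/4 - x - x\<^sup>2) * x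
      + d\<^sup>2 * (1/2 - \<mu>\<^sup>2 - \<mu> * d / 2 - d\<^sup>2 / 6)"
    unfolding upper_def lower_def \<kappa>_def slope_def unfolding \<beta> unfolding \<mu>
    by (simp add: field_simps power2_eq_square power3_eq_cube)
  \<comment> \<open>The bound \<open>d \<le> 1/2 - x\<close>, that is
    \<open>\<beta> \<le> 1\<close>, removes \<open>d\<close> from the coefficient of
    \<open>d^2\<close>.\<close>
  moreover have "(1/2 - 5*x - 4*x\<^sup>2) / 6 \<le> 1/2 - \<mu>\<^sup>2 - \<mu> * d / 2 - d\<^sup>2 / 6"
  proof -
    have "d * (3 * \<mu> + d) \<le> (1/2 - x) * (3 * \<mu> + (1/2 - x))"
      using d \<mu>_nonneg by (intro mult_mono) auto
    then show ?thesis
      unfolding \<mu> by (simp add: field_simps power2_eq_square)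
  qed
  then have "d\<^sup>2 * ((1/2 - 5*x - 4*x\<^sup>2) / 6) \<le> d\<^sup>2 * (1/2 - \<mu>\<^sup>2 - \<mu> * d / 2 - d\<^sup>2 / 6)"
    by (rule mult_left_mono) simp
  moreover have "- (1/50) \<le> x\<^sup>2 + d * (3/4 - x - x\<^sup>2) * x + d\<^sup>2 * (1/2 - 5*x - 4*x\<^sup>2) / 6"
  proof (cases "0 \<le> x")
    case True
    then show ?thesis
      using profile_polynomial_pos[OF True d] by linarith
  next
    case False
    then show ?thesis
      using profile_polynomial_neg[of "- x" d] x by simp
  qed
  ultimately show ?thesis by simp
qed

section \<open>The calibration argument for discrete slices\<close>

text \<open>Each rise of \<open>n * \<Theta>\<close> on the way from \<open>z1\<close> to
  \<open>z0\<close> is paid by the cost of a slice minus the multiplier. As \<open>\<kappa>\<close>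
  is affine and decreasing, the bound on the average density makes the multipliers add up to at
  least \<open>n * \<kappa> (1/2)\<close>.\<close>

theorem sum_ge:
  fixes s \<alpha> :: "nat \<Rightarrow> real" and n :: nat
  assumes n: "0 < n"
    and \<mu>: "\<And>z. z < n \<Longrightarrow> \<mu> \<le> s z"
    and \<alpha>: "\<And>z. z < n \<Longrightarrow> 0 \<le> \<alpha> z \<and> \<alpha> z \<le> 1"
    and \<beta>: "\<And>z. z < n \<Longrightarrow> \<alpha> z < 1/2 \<Longrightarrow> \<beta> \<le> s z"
    and slice: "\<And>z. z < n \<Longrightarrow> 2 * min (\<alpha> z) (1 - \<alpha> z) \<le> (s z)\<^sup>2"
    and up: "\<And>z. Suc z < n \<Longrightarrow> \<alpha> (Suc z) - \<alpha> z \<le> s z / n"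
    and down: "\<And>z. Suc z < n \<Longrightarrow> \<alpha> z - \<alpha> (Suc z) \<le> s (Suc z) / n"
    and z0: "z0 < n" "2 * (1 - \<alpha> z0) \<le> \<mu>\<^sup>2"
    and z1: "z1 < n" "2 * \<alpha> z1 \<le> \<beta>\<^sup>2"
    and avg: "(\<Sum>z<n. \<alpha> z) \<le> n / 2"
  shows "73/100 * n - 1 \<le> (1 + 1 / n) * (\<Sum>z<n. s z)"
proof -
  \<comment> \<open>The extra \<open>s z / n\<close> covers the change of \<open>\<kappa>\<close>
    between neighbouring densities, the extra \<open>1 / n\<close> the passage from
    \<open>s z\<close> to \<open>\<sigma>\<close> in \<open>step\<close>.\<close>
  define e where "e z = (1 + 1 / n) * s z - \<kappa> (\<alpha> z) + 1 / n" for z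
  have s: "0 \<le> s z" if "z < n" for z
    using \<mu>[OF that] \<mu>_nonneg by simp
  have \<kappa>_le: "\<kappa> (\<alpha> z) \<le> s z" if z: "z < n" for z
  proof (cases "\<alpha> z < 1/2")
    case True
    then show ?thesis
      using \<kappa>_le_\<beta>[of "\<alpha> z"] \<alpha> \<beta> z by force
  next
    case False
    define t where "t = max \<mu> (sqrt (2 * (1 - \<alpha> z)))"
    have t2: "2 * (1 - \<alpha> z) \<le> t\<^sup>2"
      unfolding t_def using \<alpha>[OF z] \<mu>_nonneg by (subst max_sqrt_square) auto
    have "t \<le> 1"
      unfolding t_def using False \<mu>_le \<beta>_le by (intro max_sqrt_le) auto
    then have "\<kappa> (1 - t\<^sup>2 / 2) \<le> t"
      by (intro \<kappa>_le_root) (auto simp: t_def)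
    moreover have "\<kappa> (\<alpha> z) \<le> \<kappa> (1 - t\<^sup>2 / 2)"
      using t2 by (intro \<kappa>_antimono) simp
    moreover have "t \<le> s z"
      unfolding t_def using False slice[OF z] \<mu>[OF z] s[OF z] by (intro max_sqrt_le) auto
    ultimately show ?thesis by simp
  qed
  have e_nonneg: "0 \<le> e z" if "z < n" for z
    using \<kappa>_le[OF that] s[OF that] by (simp add: e_def field_simps add_increasing2)
  have step: "n * (\<Theta> a' - \<Theta> (\<alpha> z)) \<le> e z"
    if z: "z < n" and a': "0 \<le> a'" "a' \<le> 1" "a' - \<alpha> z \<le> s z / n" for z a'
  proof (cases "a' \<le> \<alpha> z")
    case True
    then have "\<Theta> a' \<le> \<Theta> (\<alpha> z)"
      using a' \<alpha>[OF z] by (intro \<Theta>_mono) auto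
    then have "n * (\<Theta> a' - \<Theta> (\<alpha> z)) \<le> 0"
      by (simp add: mult_nonneg_nonpos)
    then show ?thesis using e_nonneg[OF z] by simp
  next
    case False
    \<comment> \<open>The shift by \<open>1 / n\<close> makes \<open>\<sigma>\<close> positive and
      raises the square by at least \<open>2 * s z / n\<close>, enough to cover the density
      \<open>a'\<close> as well as \<open>\<alpha> z\<close>.\<close>
    define \<sigma> where "\<sigma> = s z + 1 / n"
    have pos: "0 < \<sigma>" and le: "s z \<le> \<sigma>"
      using n s[OF z] by (auto simp: \<sigma>_def add_nonneg_pos)
    have sq: "(s z)\<^sup>2 + 2 * (s z / n) \<le> \<sigma>\<^sup>2"
      by (simp add: \<sigma>_def power2_eq_square algebra_simps)
    have \<kappa>: "0 \<le> \<kappa> a'" "\<kappa> a' \<le> s z" "\<kappa> (\<alpha> z) - \<kappa> a' \<le> s z / n"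
    proof -
      show "0 \<le> \<kappa> a'" using a' by (intro \<kappa>_nonneg)
      have "\<kappa> a' \<le> \<kappa> (\<alpha> z)"
        using False by (intro \<kappa>_antimono) simp
      then show "\<kappa> a' \<le> s z" using \<kappa>_le[OF z] by simp
      have "slope * (a' - \<alpha> z) \<le> 1 * (a' - \<alpha> z)"
        using slope_bounds False by (intro mult_right_mono) auto
      then show "\<kappa> (\<alpha> z) - \<kappa> a' \<le> s z / n"
        unfolding \<kappa>_diff using a'(3) by simp
    qed
    have sn: "0 \<le> s z / n"
      using s[OF z] by simp
    have "\<Theta> a' - \<Theta> (\<alpha> z) \<le> (a' - \<alpha> z) * (1 - \<kappa> a' / \<sigma>)"
    proof (rule \<Theta>_increment)
      show "2 * (1 - \<alpha> z) \<le> \<sigma>\<^sup>2" if "1/2 \<le> \<alpha> z"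
        using slice[OF z] that sq sn by simp
      show "\<beta> \<le> \<sigma> \<and> 2 * min a' (1/2) \<le> \<sigma>\<^sup>2" if "\<alpha> z < 1/2"
        using slice[OF z] \<beta>[OF z that] that sq le a'(3) by (auto simp: min_def split: if_splits)
    qed (use False a' \<alpha>[OF z] pos le \<mu>[OF z] \<kappa> in auto)
    also have "\<dots> \<le> s z / n * (1 - \<kappa> a' / \<sigma>)"
      using a'(3) \<kappa> le pos by (intro mult_right_mono) auto
    finally have "n * (\<Theta> a' - \<Theta> (\<alpha> z)) \<le> s z * (1 - \<kappa> a' / \<sigma>)"
      using n by (simp add: field_simps)
    also have "\<dots> = s z - \<kappa> a' + \<kappa> a' / \<sigma> * (1 / n)"
    proof -
      have "s z * (\<kappa> a' / \<sigma>) + \<kappa> a' / \<sigma> * (1 / n) = (s z + 1 / n) * (\<kappa> a' / \<sigma>)"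
        by (simp only: distrib_right mult.commute[of "\<kappa> a' / \<sigma>"])
      also have "\<dots> = \<kappa> a'"
        using pos by (simp add: \<sigma>_def)
      finally show ?thesis by (simp add: right_diff_distrib)
    qed
    also have "\<dots> \<le> s z - \<kappa> a' + 1 * (1 / n)"
      using \<kappa> le pos by (intro add_left_mono mult_right_mono) auto
    also have "\<dots> \<le> e z"
      using \<kappa>(3) by (simp add: e_def algebra_simps)
    finally show ?thesis .
  qed
  have "n * \<Theta> (\<alpha> z0) - n * \<Theta> (\<alpha> z1) \<le> (\<Sum>z<n. e z)"
  proof (rule telescoping_bound[of n "\<lambda>z. n * \<Theta> (\<alpha> z)"])
    show "n * \<Theta> (\<alpha> (Suc z)) - n * \<Theta> (\<alpha> z) \<le> e z" if "Suc z < n" for z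
      using step[of z "\<alpha> (Suc z)"] \<alpha>[of "Suc z"] up[of z] that by (simp add: right_diff_distrib)
    show "n * \<Theta> (\<alpha> z) - n * \<Theta> (\<alpha> (Suc z)) \<le> e (Suc z)" if "Suc z < n" for z
      using step[of "Suc z" "\<alpha> z"] \<alpha>[of z] down[of z] that by (simp add: right_diff_distrib)
  qed (use e_nonneg z0 z1 in auto)
  moreover have "\<Theta> (\<alpha> z0) = upper \<mu>"
  proof -
    have "\<mu>\<^sup>2 \<le> 1"
      using \<mu>_nonneg \<mu>_le \<beta>_le by (simp add: power_le_one)
    then have "1/2 \<le> \<alpha> z0" using z0 by simp
    moreover have "max \<mu> (sqrt (2 * (1 - \<alpha> z0))) = \<mu>"
      using max_sqrt_le[of \<mu> \<mu> "2 * (1 - \<alpha> z0)"] z0 \<mu>_nonneg by simp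
    ultimately show ?thesis by (simp add: \<Theta>_upper)
  qed
  moreover have "\<Theta> (\<alpha> z1) = - lower \<beta>"
  proof -
    have "\<beta>\<^sup>2 \<le> 1"
      using \<mu>_nonneg \<mu>_le \<beta>_le by (simp add: power_le_one)
    then have "\<alpha> z1 \<le> 1/2" using z1 by simp
    moreover have "max \<beta> (sqrt (2 * \<alpha> z1)) = \<beta>"
      using max_sqrt_le[of \<beta> \<beta> "2 * \<alpha> z1"] z1 \<mu>_nonneg \<mu>_le by simp
    ultimately show ?thesis by (simp add: \<Theta>_lower)
  qed
  moreover have "(\<Sum>z<n. e z) = (1 + 1 / n) * (\<Sum>z<n. s z) - (\<Sum>z<n. \<kappa> (\<alpha> z)) + 1"
    using n by (simp add: e_def sum.distrib sum_subtractf sum_distrib_left)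
  moreover have "n * \<kappa> (1/2) \<le> (\<Sum>z<n. \<kappa> (\<alpha> z))"
  proof -
    have "(\<Sum>z<n. \<kappa> (\<alpha> z)) - n * \<kappa> (1/2) = (\<Sum>z<n. \<kappa> (\<alpha> z) - \<kappa> (1/2))"
      by (simp add: sum_subtractf)
    also have "\<dots> = slope * (n / 2 - (\<Sum>z<n. \<alpha> z))"
      by (simp add: \<kappa>_diff sum_distrib_left[symmetric] sum_subtractf)
    also have "\<dots> \<ge> 0"
      using slope_bounds avg by simp
    finally show ?thesis by simp
  qed
  moreover have "n * (73/100) \<le> n * \<kappa> (1/2) + n * upper \<mu> + n * lower \<beta>"
    using mult_left_mono[OF total_ge, of n] by (simp add: distrib_left)
  ultimately show ?thesis by (simp only: mult_minus_right)
qed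

end

subsection \<open>Slicing the cube\<close>

text \<open>
  Send \<open>(i, j) \<in> Q\<close> to the pair formed by a point of \<open>R\<close> in row \<open>i\<close> closer to \<open>j0\<close> and a point of
  \<open>R\<close> in column \<open>j\<close> closer to \<open>i0\<close>. The strict inequalities prevent two points of \<open>Q\<close> from using the
  same two points of \<open>R\<close> in exchanged roles, which gains the factor 2.
\<close>

lemma planar_isoperimetry:
  fixes Q R :: "(nat \<times> nat) set" and i0 j0 :: nat
  assumes "finite R"
    and row: "\<And>i j. (i, j) \<in> Q \<Longrightarrow> \<exists>j'. (i, j') \<in> R \<and> \<bar>int j' - int j0\<bar> < \<bar>int j - int j0\<bar>"
    and column: "\<And>i j. (i, j) \<in> Q \<Longrightarrow> \<exists>i'. (i', j) \<in> R \<and> \<bar>int i' - int i0\<bar> < \<bar>int i - int i0\<bar>"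
  shows "2 * card Q \<le> card R * (card R - 1)"
proof -
  have "\<forall>p\<in>Q. \<exists>j'. (fst p, j') \<in> R \<and> \<bar>int j' - int j0\<bar> < \<bar>int (snd p) - int j0\<bar>"
    using row by auto
  from bchoice[OF this] obtain J
    where J: "\<And>p. p \<in> Q \<Longrightarrow> (fst p, J p) \<in> R \<and> \<bar>int (J p) - int j0\<bar> < \<bar>int (snd p) - int j0\<bar>"
    by blast
  have "\<forall>p\<in>Q. \<exists>i'. (i', snd p) \<in> R \<and> \<bar>int i' - int i0\<bar> < \<bar>int (fst p) - int i0\<bar>"
    using column by auto
  from bchoice[OF this] obtain I
    where I: "\<And>p. p \<in> Q \<Longrightarrow> (I p, snd p) \<in> R \<and> \<bar>int (I p) - int i0\<bar> < \<bar>int (fst p) - int i0\<bar>"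
    by blast
  let ?f = "\<lambda>p. {(fst p, J p), (I p, snd p)}"
  have "inj_on ?f Q"
  proof (rule inj_onI)
    fix p q assume pq: "p \<in> Q" "q \<in> Q" and "?f p = ?f q"
    then consider "(fst p, J p) = (fst q, J q)" "(I p, snd p) = (I q, snd q)"
      | "(fst p, J p) = (I q, snd q)" "(I p, snd p) = (fst q, J q)"
      by (auto simp: doubleton_eq_iff)
    then show "p = q"
    proof cases
      case 1
      then show ?thesis by (simp add: prod_eq_iff)
    next
      case 2
      then show ?thesis using I[OF pq(1)] I[OF pq(2)] by simp
    qed
  qed
  moreover have "?f ` Q \<subseteq> {X. X \<subseteq> R \<and> card X = 2}"
  proof (rule image_subsetI)
    fix p assume p: "p \<in> Q"
    have "fst p \<noteq> I p"
      using I[OF p] by auto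
    then show "?f p \<in> {X. X \<subseteq> R \<and> card X = 2}"
      using I[OF p] J[OF p] by simp
  qed
  moreover have "finite {X. X \<subseteq> R \<and> card X = 2}"
    using \<open>finite R\<close> by simp
  ultimately have "card Q \<le> card {X. X \<subseteq> R \<and> card X = 2}"
    by (rule card_inj_on_le)
  then have "card Q \<le> card R choose 2"
    by (simp add: n_subsets[OF \<open>finite R\<close>])
  then show ?thesis
    by (simp add: choose_two)
qed

lemma card_eq_sum_slices:
  assumes "finite X" "X \<subseteq> UNIV \<times> {..<n::nat}"
  shows "card X = (\<Sum>z<n. card {p. (p, z) \<in> X})"
proof -
  have fin: "finite {p. (p, z) \<in> X}" for z
    by (rule finite_subset[of _ "fst ` X"]) (use assms(1) in force)+
  have "X = (\<lambda>(z, p). (p, z)) ` (SIGMA z:{..<n}. {p. (p, z) \<in> X})" (is "_ = ?g ` ?Y")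
  proof
    show "X \<subseteq> ?g ` ?Y"
    proof
      fix v assume "v \<in> X"
      then show "v \<in> ?g ` ?Y"
        using assms(2) by (intro image_eqI[of _ _ "(snd v, fst v)"]) auto
    qed
  qed auto
  moreover have "inj_on ?g ?Y"
    by (auto simp: inj_on_def)
  ultimately have "card X = card ?Y"
    using card_image by metis
  then show ?thesis
    using fin by (simp add: card_SigmaI)
qed

lemma constant_between:
  fixes f :: "nat \<Rightarrow> 'a"
  assumes "\<And>k. min i j \<le> k \<Longrightarrow> k < max i j \<Longrightarrow> f k = f (Suc k)"
  shows "f i = f j"
proof -
  have ind: "a \<le> b \<Longrightarrow> (\<forall>k. a \<le> k \<and> k < b \<longrightarrow> f k = f (Suc k)) \<longrightarrow> f a = f b" for a b
  proof (induction b rule: dec_induct)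
    case (step b)
    then show ?case by (metis less_SucI lessI)
  qed simp
  show ?thesis
  proof (cases "i \<le> j")
    case True
    then show ?thesis
      using ind[OF True] assms by (metis max.absorb2 min.absorb1)
  next
    case False
    then have "j \<le> i" by simp
    then show ?thesis
      using ind[of j i] assms by (metis max.absorb1 min.absorb2)
  qed
qed

section \<open>Colourings of the cube outside a separator\<close>

abbreviation grid :: "nat \<Rightarrow> ((nat \<times> nat) \<times> nat) pair_pre_digraph" where
  "grid n \<equiv> path_graph n \<box> path_graph n \<box> path_graph n"

locale separated_grid =
  fixes n :: nat and S :: "((nat \<times> nat) \<times> nat) set" and col :: "(nat \<times> nat) \<times> nat \<Rightarrow> 'c"
  assumes S_subset: "S \<subseteq> pverts (grid n)"
    and col_edge: "\<And>u v. (u, v) \<in> parcs (grid n) \<Longrightarrow> u \<notin> S \<Longrightarrow> v \<notin> S \<Longrightarrow> col u = col v"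
begin

abbreviation square :: "(nat \<times> nat) set" where
  "square \<equiv> {..<n} \<times> {..<n}"

definition R :: "nat \<Rightarrow> (nat \<times> nat) set" where
  "R z = {p. (p, z) \<in> S}"

definition part :: "'c \<Rightarrow> nat \<Rightarrow> (nat \<times> nat) set" where
  "part c z = {p \<in> square - R z. col (p, z) = c}"

lemma R_subset: "R z \<subseteq> square"
  using S_subset by (auto simp: R_def box_product_def path_graph_def)

lemma finite_R: "finite (R z)"
  by (rule finite_subset[OF R_subset]) simp

lemma finite_part: "finite (part c z)"
  by (simp add: part_def)

text \<open>Were no point of \<open>R z\<close> strictly closer to \<open>x0\<close>, the whole
  segment from \<open>x\<close> to \<open>x0\<close> would avoid \<open>R z\<close>, and the colour
  would be constant along it.\<close>

lemma row_crossing: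
  assumes "x < n" "x0 < n" "y < n" "z < n" "(x, y) \<notin> R z" "(x0, y) \<notin> R z"
    and "col ((x, y), z) \<noteq> col ((x0, y), z)"
  shows "\<exists>x'. (x', y) \<in> R z \<and> \<bar>int x' - int x0\<bar> < \<bar>int x - int x0\<bar>"
proof (rule ccontr)
  assume none: "\<not> ?thesis"
  have free: "(k, y) \<notin> R z" if "min x x0 \<le> k" "k \<le> max x x0" for k
  proof (cases "k = x")
    case False
    then have "\<bar>int k - int x0\<bar> < \<bar>int x - int x0\<bar>"
      using that by (auto simp: min_def max_def split: if_splits)
    then show ?thesis using none by blast
  qed (use assms in simp)
  have "col ((x, y), z) = col ((x0, y), z)"
  proof (rule constant_between[of x x0 "\<lambda>k. col ((k, y), z)"])
    fix k assume "min x x0 \<le> k" "k < max x x0"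
    then show "col ((k, y), z) = col ((Suc k, y), z)"
      using assms free[of k] free[of "Suc k"]
      by (intro col_edge) (auto simp: R_def box_product_def path_graph_def)
  qed
  then show False using assms by simp
qed

lemma column_crossing:
  assumes "x < n" "y < n" "y0 < n" "z < n" "(x, y) \<notin> R z" "(x, y0) \<notin> R z"
    and "col ((x, y), z) \<noteq> col ((x, y0), z)"
  shows "\<exists>y'. (x, y') \<in> R z \<and> \<bar>int y' - int y0\<bar> < \<bar>int y - int y0\<bar>"
proof (rule ccontr)
  assume none: "\<not> ?thesis"
  have free: "(x, k) \<notin> R z" if "min y y0 \<le> k" "k \<le> max y y0" for k
  proof (cases "k = y")
    case False
    then have "\<bar>int k - int y0\<bar> < \<bar>int y - int y0\<bar>"
      using that by (auto simp: min_def max_def split: if_splits)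
    then show ?thesis using none by blast
  qed (use assms in simp)
  have "col ((x, y), z) = col ((x, y0), z)"
  proof (rule constant_between[of y y0 "\<lambda>k. col ((x, k), z)"])
    fix k assume "min y y0 \<le> k" "k < max y y0"
    then show "col ((x, k), z) = col ((x, Suc k), z)"
      using assms free[of k] free[of "Suc k"]
      by (intro col_edge) (auto simp: R_def box_product_def path_graph_def)
  qed
  then show False using assms by simp
qed

text \<open>Fewer than \<open>n\<close> points miss some line in each direction. These two lines
  form a cross of one colour; from a point of any other colour, both axis-parallel segments to the
  cross must hit \<open>R z\<close>, so \<open>planar_isoperimetry\<close> applies.\<close>

lemma dominant_colour:
  assumes "z < n" "card (R z) < n"
  shows "\<exists>c. 2 * card (square - R z - part c z) \<le> card (R z) * (card (R z) - 1)"
proof -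
  have missed: "\<exists>k<n. k \<notin> f ` R z" for f :: "nat \<times> nat \<Rightarrow> nat"
  proof (rule ccontr)
    assume "\<not> ?thesis"
    then have "{..<n} \<subseteq> f ` R z" by blast
    then have "n \<le> card (f ` R z)"
      using finite_R card_mono[of "f ` R z" "{..<n}"] by simp
    then show False
      using assms(2) card_image_le[OF finite_R, of f z] by simp
  qed
  obtain x0 y0 where x0: "x0 < n" "x0 \<notin> fst ` R z" and y0: "y0 < n" "y0 \<notin> snd ` R z"
    using missed by metis
  have col_free: "(x0, y) \<notin> R z" and row_free: "(x, y0) \<notin> R z" for x y
    using x0 y0 by force+
  define c where "c = col ((x0, y0), z)"
  have col_c: "col ((x0, y), z) = c" if "y < n" for y
    using column_crossing[of x0 y y0 z] that x0 y0 assms(1) col_free by (auto simp: c_def)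
  have row_c: "col ((x, y0), z) = c" if "x < n" for x
    using row_crossing[of x x0 y0 z] that x0 y0 assms(1) row_free by (auto simp: c_def)
  have "2 * card (square - R z - part c z) \<le> card (R z) * (card (R z) - 1)"
  proof (rule planar_isoperimetry[OF finite_R])
    fix x y assume "(x, y) \<in> square - R z - part c z"
    then have xy: "x < n" "y < n" "(x, y) \<notin> R z" "col ((x, y), z) \<noteq> c"
      by (auto simp: part_def)
    show "\<exists>y'. (x, y') \<in> R z \<and> \<bar>int y' - int y0\<bar> < \<bar>int y - int y0\<bar>"
      using xy y0 assms(1) row_free row_c by (intro column_crossing) auto
    show "\<exists>x'. (x', y) \<in> R z \<and> \<bar>int x' - int x0\<bar> < \<bar>int x - int x0\<bar>"
      using xy x0 assms(1) col_free col_c by (intro row_crossing) auto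
  qed
  then show ?thesis by blast
qed

text \<open>Edges between neighbouring slices preserve the colour unless they end in
  \<open>R z'\<close>.\<close>

lemma part_jump:
  assumes "z < n" "z' < n" "z' = Suc z \<or> z = Suc z'"
  shows "card (part c z) \<le> card (part c z') + card (R z')"
proof -
  have "part c z \<subseteq> part c z' \<union> R z'"
  proof
    fix p assume p: "p \<in> part c z"
    show "p \<in> part c z' \<union> R z'"
    proof (cases "p \<in> R z'")
      case False
      have "col (p, z) = col (p, z')"
        using p False assms by (intro col_edge) (auto simp: part_def R_def box_product_def path_graph_def)
      then show ?thesis using p False by (auto simp: part_def)
    qed simp
  qed
  then have "card (part c z) \<le> card (part c z' \<union> R z')"
    by (intro card_mono) (auto simp: finite_R finite_part)
  then show ?thesis
    using card_Un_le order_trans by blast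
qed

lemma card_S: "card S = (\<Sum>z<n. card (R z))"
proof -
  have "S \<subseteq> square \<times> {..<n}"
    using S_subset by (auto simp: box_product_def path_graph_def)
  then show ?thesis
    unfolding R_def by (intro card_eq_sum_slices) (auto intro: finite_subset)
qed

lemma card_part:
  "card {v \<in> pverts (grid n) - S. col v = c} = (\<Sum>z<n. card (part c z))"
proof -
  let ?X = "{v \<in> pverts (grid n) - S. col v = c}"
  have sub: "?X \<subseteq> square \<times> {..<n}"
    by (auto simp: box_product_def path_graph_def)
  have "card ?X = (\<Sum>z<n. card {p. (p, z) \<in> ?X})"
    using sub by (intro card_eq_sum_slices) (auto intro: finite_subset)
  also have "\<dots> = (\<Sum>z<n. card (part c z))"
    by (intro sum.cong arg_cong[of _ _ card]) (auto simp: part_def R_def box_product_def path_graph_def)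
  finally show ?thesis .
qed

theorem card_separator_ge:
  assumes n: "0 < n"
    and half: "\<And>c. 2 * card {v \<in> pverts (grid n) - S. col v = c} \<le> n ^ 3"
  shows "73/100 * (real n)\<^sup>2 - 4 * real n \<le> card S"
proof (cases "\<exists>z<n. card (R z) < n")
  case False
  have "n \<le> card (R z)" if "z < n" for z
    using False that not_less by blast
  then have "(\<Sum>z<n. n) \<le> (\<Sum>z<n. card (R z))"
    by (intro sum_mono) simp
  then have "n\<^sup>2 \<le> card S"
    by (simp add: card_S power2_eq_square)
  then have "(real n)\<^sup>2 \<le> real (card S)"
    by (metis of_nat_le_iff of_nat_power)
  moreover have "0 \<le> (real n)\<^sup>2" "0 \<le> real n" by simp_all
  ultimately show ?thesis by linarith
next
  case True
  let ?r = "\<lambda>z. card (R z)"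
  \<comment> \<open>With the added 1, \<open>(s z)^2\<close> dominates
    \<open>r * (r + 1) / n^2\<close> for \<open>r = ?r z\<close>, while \<open>s z \<le> 1\<close>
    still holds when \<open>r < n\<close>.\<close>
  define s where "s z = (real (?r z) + 1) / n" for z
  obtain z0 where z0: "z0 < n" and min0: "\<And>z. z < n \<Longrightarrow> ?r z0 \<le> ?r z"
    using ex_has_least_nat[of "\<lambda>z. z < n" 0 ?r] n by blast
  have r0: "?r z0 < n"
    using True min0 by (meson le_less_trans)
  have "\<forall>z. \<exists>c. z < n \<and> ?r z < n \<longrightarrow> 2 * card (square - R z - part c z) \<le> ?r z * (?r z - 1)"
    using dominant_colour by blast
  then obtain dom where dom: "\<And>z. z < n \<Longrightarrow> ?r z < n \<Longrightarrow>
      2 * card (square - R z - part (dom z) z) \<le> ?r z * (?r z - 1)"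
    by metis
  define A where "A = dom z0"
  define \<alpha> where "\<alpha> z = real (card (part A z)) / (real n)\<^sup>2" for z
  have pos: "0 < real n" using n by simp
  have s_le: "s z \<le> s z'" if "?r z \<le> ?r z'" for z z'
    using that by (simp add: s_def divide_right_mono)
  have s_le_1: "s z \<le> 1" if "?r z < n" for z
    using that n by (simp add: s_def)
  have s_ge_1: "1 \<le> s z" if "\<not> ?r z < n" for z
    using that n by (simp add: s_def)
  have r_sq: "real (2 * m) / (real n)\<^sup>2 \<le> (s z)\<^sup>2" if "2 * m \<le> ?r z * (?r z + 1)" for m z
  proof -
    have "2 * m \<le> (?r z + 1)\<^sup>2"
      using that by (simp add: power2_eq_square)
    then have "real (2 * m) \<le> real ((?r z + 1)\<^sup>2)"
      by (rule of_nat_mono)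
    also have "\<dots> = (real (?r z) + 1)\<^sup>2"
      by (simp only: of_nat_power of_nat_add of_nat_1)
    finally have "real (2 * m) \<le> (real (?r z) + 1)\<^sup>2" .
    then show ?thesis
      by (simp add: s_def power_divide divide_right_mono)
  qed
  have total: "card (part c z) + ?r z + card (square - R z - part c z) = n\<^sup>2" for c z
  proof -
    have "part c z \<subseteq> square - R z" by (auto simp: part_def)
    then have "card (square - R z) = card (part c z) + card (square - R z - part c z)"
      using card_Diff_subset[OF finite_part] card_mono[of "square - R z" "part c z"] by simp
    moreover have "card square = ?r z + card (square - R z)"
      using card_Diff_subset[OF finite_R R_subset] card_mono[OF _ R_subset, of z] by simp
    ultimately show ?thesis by (simp add: power2_eq_square)
  qed
  have \<alpha>_bounds: "0 \<le> \<alpha> z \<and> \<alpha> z \<le> 1" for z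
  proof -
    have "card (part A z) \<le> n\<^sup>2"
      using total[of A z] by linarith
    from of_nat_mono[OF this] have "real (card (part A z)) \<le> (real n)\<^sup>2"
      by (simp only: of_nat_power)
    then show ?thesis using pos by (simp add: \<alpha>_def)
  qed
  have A_slice: "2 * (1 - \<alpha> z) \<le> (s z)\<^sup>2" if z: "z < n" "?r z < n" "dom z = A" for z
  proof -
    \<comment> \<open>Outside \<open>A\<close> lie the \<open>r\<close> points of \<open>R z\<close>
      and at most \<open>r * (r - 1) / 2\<close> points of other colours, at most
      \<open>r * (r + 1) / 2\<close> together.\<close>
    have le: "2 * (?r z + card (square - R z - part A z)) \<le> ?r z * (?r z + 1)"
      using dom[OF z(1,2)] z(3) by (cases "?r z") (auto simp: algebra_simps)
    have "real (2 * (?r z + card (square - R z - part A z))) = 2 * ((real n)\<^sup>2 - real (card (part A z)))"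
      using arg_cong[OF total[of A z], of real] by simp
    then have "real (2 * (?r z + card (square - R z - part A z))) / (real n)\<^sup>2 = 2 * (1 - \<alpha> z)"
      unfolding \<alpha>_def using pos by (simp add: field_simps)
    with r_sq[OF le] show ?thesis by (simp only:)
  qed
  have other_slice: "2 * \<alpha> z \<le> (s z)\<^sup>2" if z: "z < n" "?r z < n" "dom z \<noteq> A" for z
  proof -
    have "part A z \<subseteq> square - R z - part (dom z) z"
      using z(3) by (auto simp: part_def)
    then have "card (part A z) \<le> card (square - R z - part (dom z) z)"
      by (intro card_mono) auto
    then have "2 * card (part A z) \<le> ?r z * (?r z - 1)"
      using dom[OF z(1,2)] by simp
    also have "\<dots> \<le> ?r z * (?r z + 1)"
      by (intro mult_left_mono) auto
    finally show ?thesis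
      using r_sq[of "card (part A z)" z] by (simp add: \<alpha>_def)
  qed
  have sum_\<alpha>: "(\<Sum>z<n. \<alpha> z) \<le> real n / 2"
  proof -
    have "2 * (\<Sum>z<n. card (part A z)) \<le> n ^ 3"
      using half[of A] by (simp only: card_part)
    from of_nat_mono[OF this] have "2 * (\<Sum>z<n. real (card (part A z))) \<le> (real n) ^ 3"
      by (simp only: of_nat_mult of_nat_numeral of_nat_power of_nat_sum)
    then have "(\<Sum>z<n. real (card (part A z))) / (real n)\<^sup>2 \<le> ((real n) ^ 3 / 2) / (real n)\<^sup>2"
      by (intro divide_right_mono) auto
    moreover have "((real n) ^ 3 / 2) / (real n)\<^sup>2 = real n / 2"
      using pos by (simp add: power2_eq_square power3_eq_cube)
    ultimately show ?thesis
      by (simp add: \<alpha>_def sum_divide_distrib)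
  qed
  have one_le: "1 \<le> s z" if z: "z < n" "\<not> (?r z < n \<and> dom z \<noteq> A)" "\<alpha> z < 1/2" for z
  proof (cases "?r z < n")
    case True
    then have "2 * (1 - \<alpha> z) \<le> (s z)\<^sup>2"
      using A_slice z by blast
    then have "1 \<le> (s z)\<^sup>2"
      using z(3) by simp
    moreover have "0 \<le> s z" by (simp add: s_def)
    ultimately show ?thesis
      by (metis one_power2 power2_le_imp_le)
  qed (rule s_ge_1)
  \<comment> \<open>\<open>z1\<close> is a thinnest slice dominated by another colour and
    \<open>\<beta>\<close> its cost. If there is none, \<open>\<beta> = 1\<close> works with any
    slice of density at most 1/2, which exists by averaging.\<close>
  obtain \<beta> z1 where \<beta>: "s z0 \<le> \<beta>" "\<beta> \<le> 1" "z1 < n" "2 * \<alpha> z1 \<le> \<beta>\<^sup>2"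
    and \<beta>_lower: "\<And>z. z < n \<Longrightarrow> \<alpha> z < 1/2 \<Longrightarrow> \<beta> \<le> s z"
  proof (cases "\<exists>z. z < n \<and> ?r z < n \<and> dom z \<noteq> A")
    case True
    then obtain z1 where z1: "z1 < n" "?r z1 < n" "dom z1 \<noteq> A"
      and min1: "\<And>z. z < n \<Longrightarrow> ?r z < n \<Longrightarrow> dom z \<noteq> A \<Longrightarrow> ?r z1 \<le> ?r z"
      using ex_has_least_nat[of "\<lambda>z. z < n \<and> ?r z < n \<and> dom z \<noteq> A" _ ?r] by blast
    show thesis
    proof (rule that[of "s z1" z1])
      show "s z1 \<le> s z" if "z < n" "\<alpha> z < 1/2" for z
      proof (cases "?r z < n \<and> dom z \<noteq> A")
        case True
        then show ?thesis using min1 that(1) by (intro s_le) blast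
      next
        case False
        then show ?thesis
          using one_le[OF that(1) False that(2)] s_le_1[OF z1(2)] by linarith
      qed
      show "s z0 \<le> s z1" "s z1 \<le> 1" "2 * \<alpha> z1 \<le> (s z1)\<^sup>2"
        by (rule s_le[OF min0[OF z1(1)]], rule s_le_1[OF z1(2)], rule other_slice[OF z1])
    qed (rule z1)
  next
    case False
    have "\<exists>z<n. \<alpha> z \<le> 1/2"
    proof (rule ccontr)
      assume "\<not> ?thesis"
      then have "(\<Sum>z<n. 1/2) < (\<Sum>z<n. \<alpha> z)"
        using n by (intro sum_strict_mono) auto
      then show False using sum_\<alpha> by simp
    qed
    then obtain z1 where z1: "z1 < n" "\<alpha> z1 \<le> 1/2" by blast
    show thesis
    proof (rule that[of 1 z1])
      show "1 \<le> s z" if z: "z < n" "\<alpha> z < 1/2" for z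
        by (rule one_le[OF z(1) _ z(2)]) (use False z in blast)
    qed (use z1 s_le_1[OF r0] in simp_all)
  qed
  interpret profile "s z0" \<beta>
    using \<beta> by unfold_locales (auto simp: s_def)
  have jump: "\<alpha> z - \<alpha> z' \<le> s z' / n" if "z < n" "z' < n" "z' = Suc z \<or> z = Suc z'" for z z'
  proof -
    have "real (card (part A z)) - real (card (part A z')) \<le> real (?r z') + 1"
      using part_jump[OF that, of A] by linarith
    then have "(real (card (part A z)) - real (card (part A z'))) / (real n)\<^sup>2 \<le> (real (?r z') + 1) / (real n)\<^sup>2"
      by (rule divide_right_mono) simp
    then show ?thesis
      by (simp add: \<alpha>_def s_def diff_divide_distrib power2_eq_square)
  qed
  have "73/100 * real n - 1 \<le> (1 + 1 / real n) * (\<Sum>z<n. s z)"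
  proof (rule sum_ge[of n s \<alpha> z0 z1])
    show "2 * min (\<alpha> z) (1 - \<alpha> z) \<le> (s z)\<^sup>2" if z: "z < n" for z
    proof (cases "?r z < n")
      case True
      then show ?thesis
        using A_slice[OF z] other_slice[OF z] by (cases "dom z = A") (auto simp: min_def)
    next
      case False
      then have "1 \<le> (s z)\<^sup>2"
        using s_ge_1 by (simp add: one_le_power)
      then show ?thesis by (auto simp: min_def)
    qed
    show "\<alpha> (Suc z) - \<alpha> z \<le> s z / n" "\<alpha> z - \<alpha> (Suc z) \<le> s (Suc z) / n" if "Suc z < n" for z
      using that jump[of "Suc z" z] jump[of z "Suc z"] by simp_all
    show "2 * (1 - \<alpha> z0) \<le> (s z0)\<^sup>2"
      by (rule A_slice[OF z0 r0]) (simp add: A_def)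
    show "s z0 \<le> s z" if "z < n" for z
      using min0[OF that] by (rule s_le)
  qed (rule n \<alpha>_bounds \<beta>(3,4) z0 sum_\<alpha> | (rule \<beta>_lower; assumption))+
  moreover have "(\<Sum>z<n. s z) = card S / n + 1"
    using n by (simp add: s_def card_S sum_divide_distrib[symmetric] sum.distrib add_divide_distrib)
  ultimately have main: "73/100 * real n - 1 \<le> (1 + 1 / real n) * (card S / n + 1)"
    by simp
  show ?thesis
  proof (rule ccontr)
    \<comment> \<open>If \<open>q < 73/100 * n - 4\<close>, then \<open>q / n\<close> and
      \<open>1 / n\<close> are at most 1, so the right side of \<open>main\<close> is at most
      \<open>q + 3\<close>, less than \<open>73/100 * n - 1\<close>.\<close>
    define q where "q = card S / real n"
    have S: "real (card S) = q * real n"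
      using pos by (simp add: q_def)
    assume "\<not> ?thesis"
    then have small: "q * real n < 73/100 * (real n)\<^sup>2 - 4 * real n"
      unfolding S by simp
    then have "q * real n < (73/100 * real n - 4) * real n"
      by (simp add: power2_eq_square left_diff_distrib)
    then have q: "q < 73/100 * real n - 4"
      using pos by (simp only: mult_less_cancel_right_pos)
    then have "q / real n \<le> 1"
      using pos by simp
    moreover have "1 / real n \<le> 1"
      using n by simp
    moreover have "(1 + 1 / real n) * (q + 1) = q + q / real n + 1 / real n + 1"
      by (simp add: algebra_simps add_divide_distrib)
    ultimately show False
      using main q unfolding q_def[symmetric] by linarith
  qed
qed

end

section \<open>The treewidth bound\<close>

theorem corollary3p7:
  shows "\<forall>\<^sub>F n in sequentially.
    real_of_int (treewidth (path_graph n \<box> path_graph n \<box> path_graph n)) \<ge> 0.7172 * (real n)\<^sup>2"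
proof (rule eventually_sequentiallyI)
  fix n :: nat assume n: "400 \<le> n"
  have grid: "pair_graph (grid n)"
    by (intro pair_graph_box_product pair_graph_path_graph)
  obtain T B where TD: "tree_decomposition (grid n) T B"
    and width: "decomposition_width T B = treewidth (grid n)"
    using treewidth_attained(1)[OF grid] by blast
  obtain t col where t: "t \<in> pverts T"
    and edge: "\<And>u v. (u, v) \<in> parcs (grid n) \<Longrightarrow> u \<notin> B t \<Longrightarrow> v \<notin> B t \<Longrightarrow> col u = (col v :: nat set)"
    and half: "\<And>c. 2 * card {v \<in> pverts (grid n) - B t. col v = c} \<le> card (pverts (grid n))"
    using balanced_bag[OF grid TD] by blast
  interpret separated_grid n "B t" col
    using TD t edge by unfold_locales (auto simp: tree_decomposition_def)
  have "card (pverts (grid n)) = n ^ 3"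
    by (simp add: box_product_def path_graph_def card_cartesian_product power3_eq_cube)
  then have "73/100 * (real n)\<^sup>2 - 4 * real n \<le> card (B t)"
    using n half by (intro card_separator_ge) auto
  moreover have "card (B t) \<le> Max ((\<lambda>t. card (B t)) ` pverts T)"
    using TD t by (intro Max_ge) (auto simp: tree_decomposition_def undirected_tree_def pair_graph_iff)
  then have "real (card (B t)) \<le> real_of_int (treewidth (grid n)) + 1"
    unfolding width[symmetric] decomposition_width_def by simp
  \<comment> \<open>Here 128/10000 is 0.73 - 0.7172, and the 1 is the difference between bag size
    and width. For \<open>n \<ge> 400\<close> the right side is at least
    \<open>5.12 * n\<close>.\<close>
  moreover have "4 * real n + 1 \<le> 128/10000 * (real n)\<^sup>2"
  proof -
    have "400 \<le> real n"
      using n by simp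
    moreover from this have "400 * real n \<le> real n * real n"
      by (rule mult_right_mono) simp
    ultimately show ?thesis
      unfolding power2_eq_square by linarith
  qed
  ultimately show "0.7172 * (real n)\<^sup>2 \<le> real_of_int (treewidth (grid n))"
    by simp
qed

end
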